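(* Let $H$ be a (not necessarily finite-dimensional) complex Hilbert space, and let $E=\{a\in B(H) : a=a^*,\ 0\leq a\leq 1\}$ be its set of effects. If $\circ'$ is an invariant sequential product on $B(H)$ (i.e. on $E$) that is norm-continuous in its first coordinate, then $a\circ' b = \sqrt{a}\,b\,\sqrt{a}$ for all effects $a,b\in E$.
   Context: $B(H)$ is the algebra of bounded operators on $H$ and $B(H)^{\mathrm{sa}}$ its real vector space of self-adjoint elements with the usual order. For $a,b\in E$ the sum $a+b$ is regarded as defined in $E$ iff $a+b\leq 1$; write $a^\perp=1-a$. A sequential product on $E$ is a (total) binary operation $\circ: E\times E\to E$ such that, writing $a\mid b$ for $a\circ b=b\circ a$, for all $a,b,c\in E$: (1) $a\circ(b+c)=a\circ b+a\circ c$ whenever $b+c$ is defined in $E$; (2) $1\circ a=a$; (3) $a\circ b=0$ implies $b\circ a=0$; (4) if $a\mid b$ then $a\mid b^\perp$ and $a\circ(b\circ c)=(a\circ b)\circ c$ for all $c$; (5) if $c\mid a$ and $c\mid b$ then $c\mid (a\circ b)$, and, if $a+b$ is defined in $E$, $c\mid(a+b)$. A unital order isomorphism $\Phi:B(H)^{\mathrm{sa}}\to B(H)^{\mathrm{sa}}$ is a linear bijection with $\Phi(1)=1$ such that $v\geq 0\iff\Phi(v)\geq 0$. The sequential product is invariant if $\Phi(a\circ b)=\Phi(a)\circ\Phi(b)$ for all $a,b\in E$ and all unital order isomorphisms $\Phi$. Norm-continuous in its first coordinate means that for each fixed $b\in E$ the map $a\mapsto a\circ b$ is continuous on $E$ with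 respect to the operator norm. *)

theory Defs
  imports "HOL-Analysis.Analysis"
begin

text \<open>The superclass \<open>real_inner\<close> provides the underlying real structure, the norm and the
  topology; \<open>inner_eq_Re_cinner\<close> says that its inner product is the real part of the complex one,
  so that the norm of \<open>x\<close> is \<open>sqrt (Re (cinner x x))\<close>. The form \<open>cinner\<close> is antilinear in its
  first argument.\<close>

class complex_inner = real_inner +
  fixes scaleC :: "complex \<Rightarrow> 'a \<Rightarrow> 'a" (infixr \<open>*\<^sub>C\<close> 75)
    and cinner :: "'a \<Rightarrow> 'a \<Rightarrow> complex"
  assumes scaleC_add_right: "c *\<^sub>C (x + y) = c *\<^sub>C x + c *\<^sub>C y"
    and scaleC_add_left: "(c + d) *\<^sub>C x = c *\<^sub>C x + d *\<^sub>C x"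
    and scaleC_scaleC: "c *\<^sub>C (d *\<^sub>C x) = (c * d) *\<^sub>C x"
    and scaleC_of_real: "complex_of_real r *\<^sub>C x = r *\<^sub>R x"
    and cinner_commute: "cinner x y = cnj (cinner y x)"
    and cinner_add_right: "cinner x (y + z) = cinner x y + cinner x z"
    and cinner_scaleC_right: "cinner x (c *\<^sub>C y) = c * cinner x y"
    and inner_eq_Re_cinner: "inner x y = Re (cinner x y)"

class chilbert_space = complex_inner + complete_space
begin

subclass banach ..

end

text \<open>\<open>B(H)\<close> is the set of complex-linear elements of the type of bounded real-linear maps; the
  norm of that type is the operator norm.\<close>

definition bounded_ops :: "('a::chilbert_space \<Rightarrow>\<^sub>L 'a) set" where
  "bounded_ops = {A :: 'a \<Rightarrow>\<^sub>L 'a. \<forall>c x. A (c *\<^sub>C x) = c *\<^sub>C A x}"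

definition self_adjoint_ops :: "('a::chilbert_space \<Rightarrow>\<^sub>L 'a) set" where
  "self_adjoint_ops = {A \<in> bounded_ops. \<forall>x y. cinner (A x) y = cinner x (A y)}"

text \<open>The usual order, used on self-adjoint operators only, for which \<open>cinner x (A x)\<close> is real.\<close>

definition op_le :: "('a::chilbert_space \<Rightarrow>\<^sub>L 'a) \<Rightarrow> ('a \<Rightarrow>\<^sub>L 'a) \<Rightarrow> bool" (infix \<open>\<preceq>\<close> 50) where
  "A \<preceq> B \<longleftrightarrow> (\<forall>x. Re (cinner x (A x)) \<le> Re (cinner x (B x)))"

definition effects :: "('a::chilbert_space \<Rightarrow>\<^sub>L 'a) set" where
  "effects = {a \<in> self_adjoint_ops. 0 \<preceq> a \<and> a \<preceq> id_blinfun}"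

definition op_sqrt :: "('a::chilbert_space \<Rightarrow>\<^sub>L 'a) \<Rightarrow> ('a \<Rightarrow>\<^sub>L 'a)" where
  "op_sqrt a = (THE s. s \<in> self_adjoint_ops \<and> 0 \<preceq> s \<and> s o\<^sub>L s = a)"

text \<open>Below, only the values of \<open>sp\<close> on \<open>effects\<close> and of \<open>\<Phi>\<close> on \<open>self_adjoint_ops\<close> matter.\<close>

definition seq_commute ::
  "(('a::chilbert_space \<Rightarrow>\<^sub>L 'a) \<Rightarrow> ('a \<Rightarrow>\<^sub>L 'a) \<Rightarrow> ('a \<Rightarrow>\<^sub>L 'a)) \<Rightarrow> ('a \<Rightarrow>\<^sub>L 'a) \<Rightarrow> ('a \<Rightarrow>\<^sub>L 'a) \<Rightarrow> bool"
  where "seq_commute sp a b \<longleftrightarrow> sp a b = sp b a"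

definition sequential_product ::
  "(('a::chilbert_space \<Rightarrow>\<^sub>L 'a) \<Rightarrow> ('a \<Rightarrow>\<^sub>L 'a) \<Rightarrow> ('a \<Rightarrow>\<^sub>L 'a)) \<Rightarrow> bool" where
  "sequential_product sp \<longleftrightarrow>
    (\<forall>a\<in>effects. \<forall>b\<in>effects. sp a b \<in> effects) \<and>
    (\<forall>a\<in>effects. \<forall>b\<in>effects. \<forall>c\<in>effects. b + c \<preceq> id_blinfun \<longrightarrow> sp a (b + c) = sp a b + sp a c) \<and>
    (\<forall>a\<in>effects. sp id_blinfun a = a) \<and>
    (\<forall>a\<in>effects. \<forall>b\<in>effects. sp a b = 0 \<longrightarrow> sp b a = 0) \<and>
    (\<forall>a\<in>effects. \<forall>b\<in>effects. seq_commute sp a b \<longrightarrow>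
      seq_commute sp a (id_blinfun - b) \<and> (\<forall>c\<in>effects. sp a (sp b c) = sp (sp a b) c)) \<and>
    (\<forall>a\<in>effects. \<forall>b\<in>effects. \<forall>c\<in>effects. seq_commute sp c a \<and> seq_commute sp c b \<longrightarrow>
      seq_commute sp c (sp a b) \<and> (a + b \<preceq> id_blinfun \<longrightarrow> seq_commute sp c (a + b)))"

definition unital_order_iso ::
  "(('a::chilbert_space \<Rightarrow>\<^sub>L 'a) \<Rightarrow> ('a \<Rightarrow>\<^sub>L 'a)) \<Rightarrow> bool" where
  "unital_order_iso \<Phi> \<longleftrightarrow>
    bij_betw \<Phi> self_adjoint_ops self_adjoint_ops \<and>
    (\<forall>v\<in>self_adjoint_ops. \<forall>w\<in>self_adjoint_ops. \<Phi> (v + w) = \<Phi> v + \<Phi> w) \<and>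
    (\<forall>r. \<forall>v\<in>self_adjoint_ops. \<Phi> (r *\<^sub>R v) = r *\<^sub>R \<Phi> v) \<and>
    \<Phi> id_blinfun = id_blinfun \<and>
    (\<forall>v\<in>self_adjoint_ops. 0 \<preceq> v \<longleftrightarrow> 0 \<preceq> \<Phi> v)"

definition invariant_product ::
  "(('a::chilbert_space \<Rightarrow>\<^sub>L 'a) \<Rightarrow> ('a \<Rightarrow>\<^sub>L 'a) \<Rightarrow> ('a \<Rightarrow>\<^sub>L 'a)) \<Rightarrow> bool" where
  "invariant_product sp \<longleftrightarrow>
    (\<forall>\<Phi>. unital_order_iso \<Phi> \<longrightarrow>
      (\<forall>a\<in>effects. \<forall>b\<in>effects. \<Phi> (sp a b) = sp (\<Phi> a) (\<Phi> b)))"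

definition norm_continuous_fst ::
  "(('a::chilbert_space \<Rightarrow>\<^sub>L 'a) \<Rightarrow> ('a \<Rightarrow>\<^sub>L 'a) \<Rightarrow> ('a \<Rightarrow>\<^sub>L 'a)) \<Rightarrow> bool" where
  "norm_continuous_fst sp \<longleftrightarrow> (\<forall>b\<in>effects. continuous_on effects (\<lambda>a. sp a b))"

end

theory Submission imports Defs
begin

text \<open>For a projection \<open>p\<close>, axiom (4) with \<open>p | p\<close> gives \<open>p \<circ> (1 - p) = 0\<close>, hence
  \<open>p \<circ> b = p b p\<close>, and \<open>p | a\<close> whenever \<open>p\<close> and \<open>a\<close> commute as operators. By associativity
  \<open>p (a \<circ> b) p = (p a) \<circ> b = a \<circ> (p b p)\<close>, so the matrix element of \<open>a \<circ> b\<close> between orthonormal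
  eigenvectors \<open>e\<close>, \<open>f\<close> of \<open>a\<close> with eigenvalues \<open>l\<close>, \<open>m\<close> only involves
  \<open>l |e\<rangle>\<langle>e| + m |f\<rangle>\<langle>f|\<close>. Invariance under an antiunitary fixing \<open>e\<close> and \<open>f\<close> shows that the
  linear extension of this product multiplies \<open>X = |e\<rangle>\<langle>f| + |f\<rangle>\<langle>e|\<close> by a real number
  \<open>k(l, m)\<close>. This \<open>k\<close> is multiplicative by associativity, symmetric by invariance under the
  swap of \<open>e\<close> and \<open>f\<close>, and \<open>k(t, t) = t\<close>; so \<open>k(l, m)\<^sup>2 = k(l m, l m) = l m\<close> and
  \<open>k(l, m) = k(\<surd>l, \<surd>m)\<^sup>2 \<ge> 0\<close>, which forces \<open>k(l, m) = \<surd>l \<surd>m\<close>. This settles effects whose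
  eigenvectors span; these are norm dense, and both sides are norm continuous in \<open>a\<close>.\<close>

section \<open>Operators on the underlying real Hilbert space\<close>

text \<open>The axioms speak of effects only and give no continuity in the second argument.
  Additivity and positivity replace it: \<open>sp a\<close> extends to a positive real-linear map
  \<open>ext a\<close> on self-adjoint operators, which applies to indefinite ones such as X or the
  off-diagonal part of \<open>b\<close>. This is also how p \<circ> (1 - p) = 0 leads to p b p: the
  off-diagonal part is dominated by t p + (1 - p) / t for every t > 0, and \<open>ext p\<close>
  sends that bound to t p.

  The first argument has no additivity to build on, so the passage from approximants to
  \<open>a\<close> rests on norm continuity. The approximants are truncated binary expansions of
  \<open>a\<close>; their digits are spectral projections obtained from a square root. Having
  finitely many eigenvalues, they have eigenvectors that span H algebraically, so matrix elements
  between eigenvectors determine both sides with no limit inside H.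

  All computations take place in the underlying real Hilbert space, where complex linearity is
  commutation with \<open>imult\<close>. Antilinear symmetries then fit the same type, and real
  parts of matrix elements suffice, since the imaginary part at x is the real part at i x.\<close>

definition imult :: "'a::complex_inner \<Rightarrow> 'a" where
  "imult x = \<i> *\<^sub>C x"

lemma imult_scaleR: "imult (r *\<^sub>R x) = r *\<^sub>R imult x"
  by (simp add: imult_def scaleC_of_real[symmetric] scaleC_scaleC mult.commute)

lemma imult_add: "imult (x + y) = imult x + imult y"
  by (simp add: imult_def scaleC_add_right)

lemma imult_imult [simp]: "imult (imult x) = - x"
proof -
  have "imult (imult x) = complex_of_real (-1) *\<^sub>C x"
    by (simp add: imult_def scaleC_scaleC)
  then show ?thesis
    unfolding scaleC_of_real by simp
qed

lemma linear_imult: "linear imult"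
  by (rule linearI) (simp_all add: imult_add imult_scaleR)

lemma imult_minus: "imult (- x) = - imult x" and imult_diff: "imult (x - y) = imult x - imult y"
  and imult_zero [simp]: "imult 0 = 0"
  using linear_neg[OF linear_imult] linear_diff[OF linear_imult] linear_0[OF linear_imult] by auto

lemma scaleC_eq: "c *\<^sub>C x = Re c *\<^sub>R x + Im c *\<^sub>R imult x"
proof -
  have "c = complex_of_real (Re c) + complex_of_real (Im c) * \<i>"
    by (simp add: complex_eq_iff)
  then have "c *\<^sub>C x = (complex_of_real (Re c) + complex_of_real (Im c) * \<i>) *\<^sub>C x"
    by (rule arg_cong)
  then show ?thesis
    by (simp only: scaleC_add_left scaleC_of_real scaleC_scaleC[symmetric] imult_def)
qed

lemma cinner_imult_left: "cinner (imult x) y = - \<i> * cinner x y"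
  by (metis cinner_commute cinner_scaleC_right complex_cnj_i complex_cnj_mult imult_def)

lemma inner_imult_left: "inner (imult x) y = Im (cinner x y)"
  by (simp add: inner_eq_Re_cinner cinner_imult_left)

lemma inner_imult_right: "inner x (imult y) = - inner (imult x) y"
  by (simp add: inner_eq_Re_cinner cinner_imult_left)
    (simp add: imult_def cinner_scaleC_right)

lemma cinner_eq: "cinner x y = Complex (inner x y) (inner (imult x) y)"
  by (simp add: complex_eq_iff inner_eq_Re_cinner cinner_imult_left)

lemma inner_imult_imult [simp]: "inner (imult x) (imult y) = inner x y"
  by (simp add: inner_imult_right)

lemma inner_imult_self [simp]: "inner (imult x) x = 0" "inner x (imult x) = 0"
  using inner_imult_right[of x x] by (simp_all add: inner_commute)

lemma norm_imult [simp]: "norm (imult x) = norm x"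
  by (simp add: norm_eq_sqrt_inner)

text \<open>The imaginary part of \<open>cinner x y\<close> is \<open>inner (imult x) y\<close>, so
  an operator that commutes with \<open>imult\<close> and is symmetric for \<open>inner\<close> is
  symmetric for \<open>cinner\<close> too. From here on membership is checked over the
  reals.\<close>

lemma self_adjoint_iff:
  "A \<in> self_adjoint_ops \<longleftrightarrow>
     (\<forall>x. A (imult x) = imult (A x)) \<and> (\<forall>x y. inner (A x) y = inner x (A y))"
proof (intro iffI conjI allI)
  assume A: "A \<in> self_adjoint_ops"
  show "A (imult x) = imult (A x)" for x
    using A by (simp add: self_adjoint_ops_def bounded_ops_def imult_def)
  show "inner (A x) y = inner x (A y)" for x y
    using A by (simp add: self_adjoint_ops_def inner_eq_Re_cinner)
next
  assume A: "(\<forall>x. A (imult x) = imult (A x)) \<and> (\<forall>x y. inner (A x) y = inner x (A y))"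
  then have "A (c *\<^sub>C x) = c *\<^sub>C A x" for c x
    by (simp add: scaleC_eq blinfun.bilinear_simps)
  moreover have "cinner (A x) y = cinner x (A y)" for x y
    using A by (simp add: cinner_eq) (metis A)
  ultimately show "A \<in> self_adjoint_ops"
    by (simp add: self_adjoint_ops_def bounded_ops_def)
qed

lemma self_adjointD:
  assumes "A \<in> self_adjoint_ops"
  shows "A (imult x) = imult (A x)" "inner (A x) y = inner x (A y)"
  using assms by (auto simp: self_adjoint_iff)

lemma op_le_iff: "A \<preceq> B \<longleftrightarrow> (\<forall>x. inner x (A x) \<le> inner x (B x))"
  by (simp add: op_le_def inner_eq_Re_cinner)

lemma effects_iff:
  "a \<in> effects \<longleftrightarrow> a \<in> self_adjoint_ops \<and> (\<forall>x. 0 \<le> inner x (a x) \<and> inner x (a x) \<le> inner x x)"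
  by (auto simp: effects_def op_le_iff)

lemma effectD:
  assumes "a \<in> effects"
  shows "a \<in> self_adjoint_ops" "0 \<le> inner x (a x)" "inner x (a x) \<le> inner x x"
  using assms by (auto simp: effects_iff)

lemma self_adjoint_add: "A \<in> self_adjoint_ops \<Longrightarrow> B \<in> self_adjoint_ops \<Longrightarrow> A + B \<in> self_adjoint_ops"
  and self_adjoint_diff: "A \<in> self_adjoint_ops \<Longrightarrow> B \<in> self_adjoint_ops \<Longrightarrow> A - B \<in> self_adjoint_ops"
  and self_adjoint_scaleR: "A \<in> self_adjoint_ops \<Longrightarrow> r *\<^sub>R A \<in> self_adjoint_ops"
  and self_adjoint_zero: "0 \<in> self_adjoint_ops"
  and self_adjoint_id: "id_blinfun \<in> self_adjoint_ops"
  by (auto simp: self_adjoint_iff blinfun.bilinear_simps imult_add imult_diff imult_scaleR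
      inner_simps)

lemma self_adjoint_sandwich:
  "A \<in> self_adjoint_ops \<Longrightarrow> B \<in> self_adjoint_ops \<Longrightarrow> A o\<^sub>L B o\<^sub>L A \<in> self_adjoint_ops"
  by (auto simp: self_adjoint_iff)

lemma self_adjoint_compose:
  "A \<in> self_adjoint_ops \<Longrightarrow> B \<in> self_adjoint_ops \<Longrightarrow> A o\<^sub>L B = B o\<^sub>L A \<Longrightarrow> A o\<^sub>L B \<in> self_adjoint_ops"
  by (simp add: self_adjoint_iff) (metis blinfun_apply_blinfun_compose)

lemmas self_adjoint_intros [intro] =
  self_adjoint_add self_adjoint_diff self_adjoint_scaleR self_adjoint_zero self_adjoint_id
  self_adjoint_sandwich

declare effectD(1) [intro]

lemma blinfun_compose_linear:
  "A o\<^sub>L (B + C) = (A o\<^sub>L B) + (A o\<^sub>L C)" "(B + C) o\<^sub>L A = (B o\<^sub>L A) + (C o\<^sub>L A)"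
  "A o\<^sub>L (B - C) = (A o\<^sub>L B) - (A o\<^sub>L C)" "(B - C) o\<^sub>L A = (B o\<^sub>L A) - (C o\<^sub>L A)"
  "A o\<^sub>L (r *\<^sub>R B) = r *\<^sub>R (A o\<^sub>L B)" "(r *\<^sub>R B) o\<^sub>L A = r *\<^sub>R (B o\<^sub>L A)"
  by (rule blinfun_eqI; simp add: blinfun.bilinear_simps)+

lemma commute_iff: "A o\<^sub>L B = B o\<^sub>L A \<longleftrightarrow> (\<forall>x. A (B x) = B (A x))"
  by (metis blinfun_apply_blinfun_compose blinfun_eqI)

section \<open>Quadratic forms, Cauchy-Schwarz and norm bounds for effects\<close>

lemma self_adjoint_eqI:
  assumes "A \<in> self_adjoint_ops" "B \<in> self_adjoint_ops" "\<And>x. inner x (A x) = inner x (B x)"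
  shows "A = B"
proof -
  define D where "D = A - B"
  have D: "D \<in> self_adjoint_ops" and z: "\<And>x. inner x (D x) = 0"
    using assms by (auto simp: D_def blinfun.bilinear_simps inner_simps)
  have "inner y (D x) = 0" for x y
    using z[of "x + y"] z[of x] z[of y] self_adjointD(2)[OF D, of x y]
    by (simp add: blinfun.bilinear_simps inner_simps) (simp add: inner_commute)
  then have "D x = 0" for x
    using inner_eq_zero_iff by blast
  then show ?thesis
    by (metis D_def blinfun.diff_left blinfun_eqI eq_iff_diff_eq_0)
qed

lemma positive_Cauchy_Schwarz:
  assumes A: "A \<in> self_adjoint_ops" and pos: "\<And>x. 0 \<le> inner x (A x)"
  shows "(inner x (A y))\<^sup>2 \<le> inner x (A x) * inner y (A y)"
proof -
  let ?\<alpha> = "inner x (A x)" and ?\<beta> = "inner x (A y)" and ?\<gamma> = "inner y (A y)"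
  have q: "0 \<le> ?\<alpha> + 2 * t * ?\<beta> + t\<^sup>2 * ?\<gamma>" for t
    using pos[of "x + t *\<^sub>R y"] self_adjointD(2)[OF A, of y x]
    by (simp add: blinfun.bilinear_simps inner_simps power2_eq_square algebra_simps)
      (simp add: inner_commute)
  show ?thesis
  proof (cases "?\<gamma> = 0")
    case True
    have "?\<beta> = 0"
    proof (rule ccontr)
      assume "?\<beta> \<noteq> 0"
      \<comment> \<open>With \<gamma> = 0 the form is affine in t, and this choice of t gives it the
        value -1.\<close>
      then show False
        using q[of "- (?\<alpha> + 1) / (2 * ?\<beta>)"] True by (simp add: field_simps)
    qed
    then show ?thesis using True by simp
  next
    case False
    then have "?\<gamma> > 0" using pos[of y] by simp
    then show ?thesis
      using q[of "- ?\<beta> / ?\<gamma>"] by (simp add: power2_eq_square field_simps)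
  qed
qed

lemma positive_inner_eq_0:
  assumes "A \<in> self_adjoint_ops" "\<And>x. 0 \<le> inner x (A x)" "inner x (A x) = 0"
  shows "A x = 0"
  using positive_Cauchy_Schwarz[OF assms(1,2), of "A x" x] assms(3) by simp

text \<open>This is a^2 \<le> a. Cauchy-Schwarz for the form of \<open>a\<close> at the vectors x
  and a x bounds the square of N = |a x|^2 by the product of the two values of the form, and a \<le>
  1 bounds the second value by N, which cancels.\<close>

lemma effect_norm_sq_le:
  assumes "a \<in> effects"
  shows "(norm (a x))\<^sup>2 \<le> inner x (a x)"
proof (cases "a x = 0")
  case False
  let ?N = "(norm (a x))\<^sup>2"
  have "?N * ?N = (inner x (a (a x)))\<^sup>2"
    using self_adjointD(2)[OF effectD(1)[OF assms], of x "a x"]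
    by (simp add: power2_eq_square dot_square_norm)
  also have "\<dots> \<le> inner x (a x) * inner (a x) (a (a x))"
    using assms by (intro positive_Cauchy_Schwarz) (auto simp: effects_iff)
  also have "\<dots> \<le> inner x (a x) * ?N"
    using effectD(2)[OF assms, of x] effectD(3)[OF assms, of "a x"]
    by (intro mult_left_mono) (simp_all add: dot_square_norm)
  finally show ?thesis
    by (rule mult_right_le_imp_le) (use False in simp)
qed (simp add: assms effectD)

lemma effect_norm_le: "norm a \<le> 1" if "a \<in> effects"
proof (rule norm_blinfun_bound)
  show "norm (a x) \<le> 1 * norm x" for x
    using effect_norm_sq_le[OF that, of x] effectD(3)[OF that, of x]
    by (simp add: dot_square_norm) (metis norm_ge_zero order_trans power2_le_imp_le)
qed simp

lemma effect_diff_id: "a \<in> effects \<Longrightarrow> id_blinfun - a \<in> effects"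
  by (auto simp: effects_iff blinfun.bilinear_simps inner_simps)

lemma effect_zero: "0 \<in> effects" and effect_id: "id_blinfun \<in> effects"
  by (auto simp: effects_iff)

lemma inner_le_norm:
  fixes A :: "'a::real_inner \<Rightarrow>\<^sub>L 'a"
  shows "\<bar>inner x (A x)\<bar> \<le> norm A * inner x x"
proof -
  have "\<bar>inner x (A x)\<bar> \<le> norm x * norm (A x)"
    by (rule Cauchy_Schwarz_ineq2)
  also have "\<dots> \<le> norm x * (norm A * norm x)"
    by (intro mult_left_mono norm_blinfun) simp
  finally show ?thesis
    by (simp add: dot_square_norm power2_eq_square mult_ac)
qed

lemma self_adjoint_limit:
  assumes "\<And>n. A n \<in> self_adjoint_ops" "A \<longlonglongrightarrow> B"
  shows "B \<in> self_adjoint_ops"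
proof -
  have lim: "(\<lambda>n. A n x) \<longlonglongrightarrow> B x" for x
    by (intro tendsto_intros assms(2))
  have limi: "(\<lambda>n. imult (A n x)) \<longlonglongrightarrow> imult (B x)" for x
  proof -
    have "bounded_linear (imult :: 'a \<Rightarrow> 'a)"
      by (rule bounded_linear_intro[where K = 1]) (simp_all add: imult_add imult_scaleR)
    then show ?thesis
      using lim bounded_linear.tendsto by blast
  qed
  have "B (imult x) = imult (B x)" for x
    using LIMSEQ_unique[OF lim[of "imult x"]] limi[of x]
    by (simp add: self_adjointD(1)[OF assms(1)])
  moreover have "inner (B x) y = inner x (B y)" for x y
  proof -
    have "(\<lambda>n. inner (A n x) y) \<longlonglongrightarrow> inner (B x) y" "(\<lambda>n. inner x (A n y)) \<longlonglongrightarrow> inner x (B y)"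
      by (intro tendsto_intros lim)+
    then show ?thesis
      using LIMSEQ_unique by (simp add: self_adjointD(2)[OF assms(1)])
  qed
  ultimately show ?thesis by (simp add: self_adjoint_iff)
qed

section \<open>The square root\<close>

text \<open>If \<open>y = (z + y\<^sup>2) / 2\<close>, then \<open>(1 - y)\<^sup>2 = 1 - z\<close>. For \<open>norm z \<le> 1\<close> the fixed point
  iteration is dominated by the scalar one at \<open>z = 1\<close>, so it converges in norm, uniformly in \<open>z\<close>.\<close>

primrec sqrt_iter :: "('b::real_normed_vector \<Rightarrow>\<^sub>L 'b) \<Rightarrow> nat \<Rightarrow> ('b \<Rightarrow>\<^sub>L 'b)" where
  "sqrt_iter z 0 = 0"
| "sqrt_iter z (Suc n) = (1/2) *\<^sub>R (z + (sqrt_iter z n o\<^sub>L sqrt_iter z n))"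

primrec sqrt_bound :: "nat \<Rightarrow> real" where
  "sqrt_bound 0 = 0"
| "sqrt_bound (Suc n) = (1 + sqrt_bound n * sqrt_bound n) / 2"

definition sqrt_lim :: "('b::banach \<Rightarrow>\<^sub>L 'b) \<Rightarrow> ('b \<Rightarrow>\<^sub>L 'b)" where
  "sqrt_lim z = lim (sqrt_iter z)"

lemma sqrt_bound_ge_0: "0 \<le> sqrt_bound n"
  by (induction n) auto

lemma sqrt_bound_le_1: "sqrt_bound n \<le> 1"
proof (induction n)
  case (Suc n)
  then have "sqrt_bound n * sqrt_bound n \<le> 1 * 1"
    using sqrt_bound_ge_0[of n] by (intro mult_mono) auto
  then show ?case by simp
qed simp

lemma sqrt_bound_mono: "incseq sqrt_bound"
proof (rule incseq_SucI)
  fix n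
  have "0 \<le> (1 - sqrt_bound n)\<^sup>2" by simp
  then show "sqrt_bound n \<le> sqrt_bound (Suc n)"
    by (simp add: power2_eq_square algebra_simps)
qed

lemma sqrt_bound_tendsto: "sqrt_bound \<longlonglongrightarrow> 1"
proof -
  obtain l where l: "sqrt_bound \<longlonglongrightarrow> l"
    using incseq_convergent[OF sqrt_bound_mono] sqrt_bound_le_1 by blast
  have "(\<lambda>n. sqrt_bound (Suc n)) \<longlonglongrightarrow> (1 + l * l) / 2"
    unfolding sqrt_bound.simps by (intro tendsto_intros l) simp
  then have "(1 + l * l) / 2 = l"
    using LIMSEQ_Suc[OF l] LIMSEQ_unique by blast
  then have "(l - 1)\<^sup>2 = 0"
    by (simp add: power2_eq_square algebra_simps)
  then show ?thesis using l by simp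
qed

lemma sqrt_iter_commute:
  assumes "T o\<^sub>L z = z o\<^sub>L T"
  shows "T o\<^sub>L sqrt_iter z n = sqrt_iter z n o\<^sub>L T"
proof (induction n)
  case (Suc n)
  then show ?case
    using assms by (auto simp: commute_iff blinfun.bilinear_simps)
qed (simp add: commute_iff)

lemma sqrt_iter_commute_self: "sqrt_iter z m o\<^sub>L sqrt_iter z n = sqrt_iter z n o\<^sub>L sqrt_iter z m"
  by (metis sqrt_iter_commute)

lemma norm_sqrt_iter: "norm (sqrt_iter z n) \<le> sqrt_bound n" if "norm z \<le> 1"
proof (induction n)
  case (Suc n)
  have "norm (sqrt_iter z n o\<^sub>L sqrt_iter z n) \<le> sqrt_bound n * sqrt_bound n"
    using norm_blinfun_compose[of "sqrt_iter z n" "sqrt_iter z n"] Suc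
    by (smt (verit) mult_mono norm_ge_zero)
  then show ?case
    using that Suc norm_triangle_ineq[of z "sqrt_iter z n o\<^sub>L sqrt_iter z n"] by simp
qed simp

text \<open>The iterates commute, so consecutive differences factor as v^2 - u^2 = (v + u) (v - u).
  The scalar sequence obeys the same factorisation with equality, and the bound passes from one step
  to the next.\<close>

lemma norm_sqrt_iter_Suc_diff:
  assumes "norm z \<le> 1"
  shows "norm (sqrt_iter z (Suc n) - sqrt_iter z n) \<le> sqrt_bound (Suc n) - sqrt_bound n"
proof (induction n)
  case (Suc n)
  let ?y = "sqrt_iter z n" and ?y' = "sqrt_iter z (Suc n)"
  have "sqrt_iter z (Suc (Suc n)) - ?y' = (1/2) *\<^sub>R ((?y' + ?y) o\<^sub>L (?y' - ?y))"
  proof (rule blinfun_eqI)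
    fix x
    define u v where "u = ?y" and "v = ?y'"
    have uv: "v (u x) = u (v x)"
      using sqrt_iter_commute_self[of z n "Suc n"] unfolding u_def v_def commute_iff by simp
    have v: "v x = (1/2) *\<^sub>R (z x + u (u x))"
      by (simp add: u_def v_def blinfun.bilinear_simps)
    have "sqrt_iter z (Suc (Suc n)) x = (1/2) *\<^sub>R (z x + v (v x))"
      by (simp add: v_def blinfun.bilinear_simps del: sqrt_iter.simps) (simp add: blinfun.bilinear_simps)
    then have "(sqrt_iter z (Suc (Suc n)) - v) x = (1/2) *\<^sub>R (z x + v (v x)) - (1/2) *\<^sub>R (z x + u (u x))"
      using v by (simp add: blinfun.diff_left del: sqrt_iter.simps)
    also have "\<dots> = ((1/2) *\<^sub>R ((v + u) o\<^sub>L (v - u))) x"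
      using uv by (simp add: blinfun.bilinear_simps algebra_simps)
    finally show "(sqrt_iter z (Suc (Suc n)) - ?y') x = ((1/2) *\<^sub>R ((?y' + ?y) o\<^sub>L (?y' - ?y))) x"
      unfolding u_def v_def .
  qed
  also have "norm \<dots> \<le> (1/2) * (norm (?y' + ?y) * norm (?y' - ?y))"
    using norm_blinfun_compose[of "?y' + ?y" "?y' - ?y"] by simp
  also have "\<dots> \<le> (1/2) * ((sqrt_bound (Suc n) + sqrt_bound n) * (sqrt_bound (Suc n) - sqrt_bound n))"
    using norm_sqrt_iter[OF assms, of n] norm_sqrt_iter[OF assms, of "Suc n"] Suc
      norm_triangle_ineq[of ?y' ?y]
    by (intro mult_left_mono mult_mono) (auto simp del: sqrt_iter.simps sqrt_bound.simps
        intro: add_nonneg_nonneg sqrt_bound_ge_0)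
  also have "\<dots> = sqrt_bound (Suc (Suc n)) - sqrt_bound (Suc n)"
    by (simp add: field_simps)
  finally show ?case .
qed (use assms in simp)

lemma norm_sqrt_iter_diff:
  assumes "norm z \<le> 1" "n \<le> m"
  shows "norm (sqrt_iter z m - sqrt_iter z n) \<le> sqrt_bound m - sqrt_bound n"
  using assms(2)
proof (induction m rule: dec_induct)
  case (step m)
  then show ?case
    using norm_sqrt_iter_Suc_diff[OF assms(1), of m]
      norm_triangle_ineq[of "sqrt_iter z (Suc m) - sqrt_iter z m" "sqrt_iter z m - sqrt_iter z n"]
    by (simp del: sqrt_iter.simps sqrt_bound.simps)
qed simp

lemma sqrt_iter_tendsto:
  assumes "norm z \<le> 1"
  shows "sqrt_iter z \<longlonglongrightarrow> sqrt_lim z"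
proof -
  have "Cauchy (sqrt_iter z)"
  proof (rule CauchyI')
    fix e :: real assume "e > 0"
    then obtain N where N: "norm (sqrt_bound m - 1) < e" if "m \<ge> N" for m
      using LIMSEQ_D[OF sqrt_bound_tendsto] by meson
    have "norm (sqrt_iter z m - sqrt_iter z n) < e" if "m \<ge> N" "n > m" for m n
      using norm_sqrt_iter_diff[OF assms, of m n] N[of m] sqrt_bound_le_1[of m] sqrt_bound_le_1[of n]
        that by (simp add: norm_minus_commute)
    then show "\<exists>M. \<forall>m\<ge>M. \<forall>n>m. dist (sqrt_iter z m) (sqrt_iter z n) < e"
      unfolding dist_norm by blast
  qed
  then show ?thesis
    unfolding sqrt_lim_def by (metis Cauchy_convergent_iff convergent_LIMSEQ_iff)
qed

lemma norm_sqrt_lim_diff: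
  assumes "norm z \<le> 1"
  shows "norm (sqrt_lim z - sqrt_iter z n) \<le> 1 - sqrt_bound n"
proof (rule LIMSEQ_le)
  show "(\<lambda>m. norm (sqrt_iter z m - sqrt_iter z n)) \<longlonglongrightarrow> norm (sqrt_lim z - sqrt_iter z n)"
    by (intro tendsto_intros sqrt_iter_tendsto assms)
  show "(\<lambda>m. sqrt_bound m - sqrt_bound n) \<longlonglongrightarrow> 1 - sqrt_bound n"
    by (intro tendsto_intros sqrt_bound_tendsto)
  show "\<exists>N. \<forall>m\<ge>N. norm (sqrt_iter z m - sqrt_iter z n) \<le> sqrt_bound m - sqrt_bound n"
    using norm_sqrt_iter_diff[OF assms] by blast
qed

lemma norm_sqrt_lim: "norm z \<le> 1 \<Longrightarrow> norm (sqrt_lim z) \<le> 1"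
  using norm_sqrt_lim_diff[of z 0] by simp

lemma sqrt_lim_fixpoint:
  assumes "norm z \<le> 1"
  shows "sqrt_lim z = (1/2) *\<^sub>R (z + (sqrt_lim z o\<^sub>L sqrt_lim z))"
proof -
  have "(\<lambda>n. sqrt_iter z (Suc n)) \<longlonglongrightarrow> (1/2) *\<^sub>R (z + (sqrt_lim z o\<^sub>L sqrt_lim z))"
    unfolding sqrt_iter.simps
    by (intro tendsto_intros bounded_bilinear.tendsto[OF bounded_bilinear_blinfun_compose]
        sqrt_iter_tendsto assms)
  then show ?thesis
    using LIMSEQ_Suc[OF sqrt_iter_tendsto[OF assms]] LIMSEQ_unique by blast
qed

lemma sqrt_lim_commute:
  assumes "norm z \<le> 1" "T o\<^sub>L z = z o\<^sub>L T"
  shows "T o\<^sub>L sqrt_lim z = sqrt_lim z o\<^sub>L T"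
proof -
  have "(\<lambda>n. T o\<^sub>L sqrt_iter z n) \<longlonglongrightarrow> (T o\<^sub>L sqrt_lim z)"
    "(\<lambda>n. sqrt_iter z n o\<^sub>L T) \<longlonglongrightarrow> (sqrt_lim z o\<^sub>L T)"
    by (intro bounded_bilinear.tendsto[OF bounded_bilinear_blinfun_compose] tendsto_intros
        sqrt_iter_tendsto assms)+
  then show ?thesis
    using LIMSEQ_unique by (simp add: sqrt_iter_commute[OF assms(2)])
qed

text \<open>Every iterate is a polynomial in \<open>z\<close>, and the error
  \<open>1 - sqrt_bound n\<close> does not depend on \<open>z\<close>. The norm continuity of
  \<open>op_sqrt\<close> comes from here.\<close>

lemma continuous_on_sqrt_lim: "continuous_on {z. norm z \<le> 1} sqrt_lim"
proof (rule uniform_limit_theorem)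
  show "\<forall>\<^sub>F n in sequentially. continuous_on {z. norm z \<le> 1} (\<lambda>z. sqrt_iter z n)"
  proof (intro always_eventually allI)
    fix n show "continuous_on {z. norm z \<le> 1} (\<lambda>z. sqrt_iter z n)"
      by (induction n)
        (auto intro!: continuous_intros
          bounded_bilinear.continuous_on[OF bounded_bilinear_blinfun_compose])
  qed
  show "uniform_limit {z. norm z \<le> 1} (\<lambda>n z. sqrt_iter z n) sqrt_lim sequentially"
    unfolding uniform_limit_iff
  proof (intro allI impI)
    fix e :: real assume "e > 0"
    then have "\<forall>\<^sub>F n in sequentially. dist (sqrt_bound n) 1 < e"
      using sqrt_bound_tendsto tendstoD by blast
    then show "\<forall>\<^sub>F n in sequentially. \<forall>z\<in>{z. norm z \<le> 1}. dist (sqrt_iter z n) (sqrt_lim z) < e"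
    proof (rule eventually_mono)
      fix n assume "dist (sqrt_bound n) 1 < e"
      then show "\<forall>z\<in>{z. norm z \<le> 1}. dist (sqrt_iter z n) (sqrt_lim z) < e"
        using norm_sqrt_lim_diff[of _ n] sqrt_bound_le_1[of n]
        by (fastforce simp: dist_norm norm_minus_commute intro: order_le_less_trans)
    qed
  qed
qed simp

section \<open>Positive square roots of effects: existence, uniqueness, continuity\<close>

lemma sqrt_iter_self_adjoint: "z \<in> self_adjoint_ops \<Longrightarrow> sqrt_iter z n \<in> self_adjoint_ops"
  by (induction n) (auto intro!: self_adjoint_intros self_adjoint_compose)

text \<open>For y = (s - t) x, commutation gives (s + t) y = (s^2 - t^2) x = 0. Both forms are
  nonnegative at y and add up to 0, so s y = t y = 0, and then |y|^2 = \<langle>x, (s - t)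
  y\<rangle> = 0.\<close>

lemma op_sqrt_unique:
  fixes s t :: "'a::chilbert_space \<Rightarrow>\<^sub>L 'a"
  assumes s: "s \<in> self_adjoint_ops" "0 \<preceq> s" and t: "t \<in> self_adjoint_ops" "0 \<preceq> t"
    and comm: "s o\<^sub>L t = t o\<^sub>L s" and eq: "s o\<^sub>L s = t o\<^sub>L t"
  shows "s = t"
proof (rule blinfun_eqI)
  fix x
  define y where "y = s x - t x"
  have "s y + t y = 0"
    using comm eq by (simp add: y_def blinfun.bilinear_simps commute_iff)
      (metis blinfun_apply_blinfun_compose)
  then have "inner y (s y) + inner y (t y) = 0"
    by (metis inner_add_right inner_zero_right)
  then have "inner y (s y) = 0" "inner y (t y) = 0"
    using s(2) t(2) by (simp_all add: op_le_iff add_nonneg_eq_0_iff)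
  then have "s y = 0" "t y = 0"
    using s t by (auto intro!: positive_inner_eq_0 simp: op_le_iff)
  then have "inner y y = 0"
    using self_adjointD(2)[OF s(1), of x y] self_adjointD(2)[OF t(1), of x y]
    by (simp add: y_def inner_diff_left)
  then show "s x = t x" by (simp add: y_def)
qed

lemma effect_id_diff_norm: "a \<in> effects \<Longrightarrow> norm (id_blinfun - a) \<le> 1"
  by (intro effect_norm_le effect_diff_id)

text \<open>The commutation clause also yields uniqueness: a competing root t commutes with t^2 = a,
  hence with s, and \<open>op_sqrt_unique\<close> applies. This shows that the description in
  \<open>op_sqrt\<close> denotes s.\<close>

lemma op_sqrt_aux:
  fixes a :: "'a::chilbert_space \<Rightarrow>\<^sub>L 'a"
  assumes "a \<in> effects"
  defines "s \<equiv> id_blinfun - sqrt_lim (id_blinfun - a)"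
  shows "s \<in> self_adjoint_ops" "0 \<preceq> s" "s o\<^sub>L s = a"
    "\<And>T. T o\<^sub>L a = a o\<^sub>L T \<Longrightarrow> T o\<^sub>L s = s o\<^sub>L T" "op_sqrt a = s"
proof -
  note n = effect_id_diff_norm[OF assms(1)]
  let ?y = "sqrt_lim (id_blinfun - a)"
  have "?y \<in> self_adjoint_ops"
    using assms(1) by (intro self_adjoint_limit[OF _ sqrt_iter_tendsto[OF n]] sqrt_iter_self_adjoint) auto
  then show sa: "s \<in> self_adjoint_ops" by (auto simp: s_def)
  show pos: "0 \<preceq> s"
    unfolding op_le_iff
  proof
    fix x :: 'a
    have "norm ?y * inner x x \<le> inner x x"
      using norm_sqrt_lim[OF n] mult_right_mono[of "norm ?y" 1 "inner x x"] by simp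
    then show "inner x (blinfun_apply 0 x) \<le> inner x (s x)"
      using inner_le_norm[of x ?y]
      by (simp add: s_def blinfun.bilinear_simps inner_diff_right)
  qed
  have "2 *\<^sub>R ?y = id_blinfun - a + (?y o\<^sub>L ?y)"
    by (subst sqrt_lim_fixpoint[OF n]) simp
  from arg_cong[OF this, of blinfun_apply] have "2 *\<^sub>R ?y x = x - a x + ?y (?y x)" for x
    by (simp add: fun_eq_iff blinfun.bilinear_simps)
  then show sq: "s o\<^sub>L s = a"
    by (intro blinfun_eqI) (simp add: s_def blinfun.bilinear_simps scaleR_2 algebra_simps)
  show comm: "T o\<^sub>L s = s o\<^sub>L T" if "T o\<^sub>L a = a o\<^sub>L T" for T
  proof -
    have "T o\<^sub>L (id_blinfun - a) = (id_blinfun - a) o\<^sub>L T"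
      using that by (simp add: commute_iff blinfun.bilinear_simps)
    from sqrt_lim_commute[OF n this] show ?thesis
      by (simp add: s_def commute_iff blinfun.bilinear_simps)
  qed
  show "op_sqrt a = s"
    unfolding op_sqrt_def
  proof (rule the_equality)
    fix t assume t: "t \<in> self_adjoint_ops \<and> 0 \<preceq> t \<and> t o\<^sub>L t = a"
    then have "t o\<^sub>L a = a o\<^sub>L t" by (auto simp: commute_iff)
    from comm[OF this] show "t = s"
      using t sa pos sq op_sqrt_unique by metis
  qed (intro conjI sa pos sq)
qed

lemma op_sqrt:
  assumes "a \<in> effects"
  shows "op_sqrt a \<in> self_adjoint_ops" "0 \<preceq> op_sqrt a" "op_sqrt a o\<^sub>L op_sqrt a = a"
    "T o\<^sub>L a = a o\<^sub>L T \<Longrightarrow> T o\<^sub>L op_sqrt a = op_sqrt a o\<^sub>L T"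
  unfolding op_sqrt_aux(5)[OF assms] by (fact op_sqrt_aux[OF assms])+

lemma continuous_on_op_sqrt: "continuous_on effects op_sqrt"
proof -
  have "continuous_on effects (\<lambda>a::'a \<Rightarrow>\<^sub>L 'a. sqrt_lim (id_blinfun - a))"
    by (intro continuous_on_compose2[OF continuous_on_sqrt_lim])
      (auto intro!: continuous_intros effect_id_diff_norm)
  then have "continuous_on effects (\<lambda>a::'a \<Rightarrow>\<^sub>L 'a. id_blinfun - sqrt_lim (id_blinfun - a))"
    by (intro continuous_intros)
  then show ?thesis
    by (rule continuous_on_eq) (simp add: op_sqrt_aux(5))
qed

text \<open>From (s + \<surd>l) (s - \<surd>l) x = 0, the vector y = (s - \<surd>l) x satisfies s y
  = - \<surd>l y. Positivity of s leaves only y = 0 or l = 0, and in the latter case |s x|^2 =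
  \<langle>x, a x\<rangle> = 0.\<close>

lemma op_sqrt_eigenvector:
  assumes a: "a \<in> effects" and e: "a x = l *\<^sub>R x"
  shows "op_sqrt a x = sqrt l *\<^sub>R x"
proof (cases "x = 0")
  case False
  have "0 \<le> l"
    using effectD(2)[OF a, of x] False e inner_gt_zero_iff[of x] mult_neg_pos[of l "inner x x"]
    by (force simp: not_le)
  let ?s = "op_sqrt a"
  note s = op_sqrt[OF a]
  have pos: "0 \<le> inner y (?s y)" for y
    using s(2) by (simp add: op_le_iff)
  have sq: "?s (?s x) = l *\<^sub>R x"
    using s(3) e by (metis blinfun_apply_blinfun_compose)
  define y where "y = ?s x - sqrt l *\<^sub>R x"
  have sy: "?s y = - sqrt l *\<^sub>R y"
    using sq \<open>0 \<le> l\<close> by (simp add: y_def blinfun.bilinear_simps algebra_simps)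
  then have "sqrt l * inner y y \<le> 0"
    using pos[of y] by simp
  then have "y = 0 \<or> l = 0"
    using \<open>0 \<le> l\<close> by (metis inner_gt_zero_iff le_less linorder_not_less mult_pos_pos real_sqrt_gt_zero)
  moreover have "y = 0" if "l = 0"
  proof -
    have "inner (?s x) (?s x) = inner x (?s (?s x))"
      using self_adjointD(2)[OF s(1)] by simp
    then show ?thesis using that sq by (simp add: y_def)
  qed
  ultimately show ?thesis by (auto simp: y_def)
qed (simp add: blinfun.bilinear_simps)

section \<open>Orthogonal projections\<close>

text \<open>The midpoint of two terms of a minimising sequence stays in M, so the parallelogram law
  makes the sequence Cauchy. Its limit attains the distance from x to M, which forces
  orthogonality.\<close>

lemma orthogonal_decomposition_exists:
  fixes M :: "'a::{real_inner, complete_space} set"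
  assumes M: "subspace M" "closed M"
  shows "\<exists>y\<in>M. \<forall>z\<in>M. inner (x - y) z = 0"
proof -
  define D where "D = Inf ((\<lambda>y. (norm (x - y))\<^sup>2) ` M)"
  have bdd: "bdd_below ((\<lambda>y. (norm (x - y))\<^sup>2) ` M)"
    by (rule bdd_belowI[of _ 0]) auto
  have D_le: "D \<le> (norm (x - y))\<^sup>2" if "y \<in> M" for y
    unfolding D_def using bdd that by (intro cInf_lower) auto
  have "\<exists>y\<in>M. (norm (x - y))\<^sup>2 < D + 1 / real (Suc n)" for n
    using cInf_lessD[of "(\<lambda>y. (norm (x - y))\<^sup>2) ` M" "D + 1 / real (Suc n)"] subspace_0[OF M(1)]
    by (auto simp: D_def)
  then obtain y where y: "\<And>n. y n \<in> M" "\<And>n. (norm (x - y n))\<^sup>2 < D + 1 / real (Suc n)"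
    by metis
  have diff: "(norm (y m - y n))\<^sup>2 \<le> 2 / real (Suc m) + 2 / real (Suc n)" for m n
  proof -
    have "(1/2) *\<^sub>R (y m + y n) \<in> M"
      using y(1) M(1) by (intro subspace_scale subspace_add)
    then have "D \<le> (norm (x - (1/2) *\<^sub>R (y m + y n)))\<^sup>2"
      by (rule D_le)
    moreover have "(norm (y m - y n))\<^sup>2 + 4 * (norm (x - (1/2) *\<^sub>R (y m + y n)))\<^sup>2
        = 2 * (norm (x - y m))\<^sup>2 + 2 * (norm (x - y n))\<^sup>2"
      unfolding power2_norm_eq_inner by (simp add: inner_simps inner_commute algebra_simps)
    ultimately show ?thesis
      using y(2)[of m] y(2)[of n] by simp
  qed
  have "Cauchy y"
  proof (rule CauchyI)
    fix e :: real assume e: "e > 0"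
    then obtain N where N: "inverse (real (Suc N)) < e\<^sup>2 / 4"
      using reals_Archimedean[of "e\<^sup>2 / 4"] by auto
    have "norm (y m - y n) < e" if "m \<ge> N" "n \<ge> N" for m n
    proof -
      have "1 / real (Suc m) \<le> 1 / real (Suc N)" "1 / real (Suc n) \<le> 1 / real (Suc N)"
        using that by (auto intro!: divide_left_mono)
      then have "(norm (y m - y n))\<^sup>2 < e\<^sup>2"
        using diff[of m n] N by (simp add: inverse_eq_divide)
      then show ?thesis
        using e by (simp add: power_less_imp_less_base)
    qed
    then show "\<exists>M. \<forall>m\<ge>M. \<forall>n\<ge>M. norm (y m - y n) < e" by blast
  qed
  then obtain p where p: "y \<longlonglongrightarrow> p"
    using Cauchy_convergent_iff convergent_def by blast
  have pM: "p \<in> M"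
    using closed_sequentially[OF M(2)] y(1) p by blast
  have "(\<lambda>n. D + 1 / real (Suc n)) \<longlonglongrightarrow> D + 0"
    by (intro tendsto_intros lim_inverse_n'[THEN LIMSEQ_Suc])
  moreover have "(\<lambda>n. (norm (x - y n))\<^sup>2) \<longlonglongrightarrow> (norm (x - p))\<^sup>2"
    by (intro tendsto_intros p)
  ultimately have pD: "(norm (x - p))\<^sup>2 \<le> D"
    using y(2) by (intro LIMSEQ_le[of _ "(norm (x - p))\<^sup>2" _ D]) (auto intro: less_imp_le)
  have "inner (x - p) z = 0" if z: "z \<in> M" for z
  proof (cases "z = 0")
    case False
    \<comment> \<open>This is the coefficient of x - p along z; moving p by t z would shorten the
      distance unless the coefficient is 0.\<close>
    define t where "t = inner (x - p) z / inner z z"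
    have "p + t *\<^sub>R z \<in> M"
      using M(1) pM z by (intro subspace_add subspace_scale)
    from order_trans[OF pD D_le[OF this]]
    have "(norm (x - p))\<^sup>2 \<le> (norm (x - p - t *\<^sub>R z))\<^sup>2"
      by (simp only: diff_diff_add)
    also have "\<dots> = (norm (x - p))\<^sup>2 - 2 * t * inner (x - p) z + t\<^sup>2 * inner z z"
      unfolding power2_norm_eq_inner
      by (simp add: inner_diff_left inner_diff_right inner_commute power2_eq_square algebra_simps)
    also have "\<dots> = (norm (x - p))\<^sup>2 - (inner (x - p) z)\<^sup>2 / inner z z"
      using False by (simp add: t_def power2_eq_square)
    finally have "(inner (x - p) z)\<^sup>2 / inner z z \<le> 0" by simp
    then have "(inner (x - p) z)\<^sup>2 \<le> 0"
      using False by (simp add: divide_le_0_iff) (metis inner_gt_zero_iff not_le)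
    then show ?thesis by simp
  qed simp
  then show ?thesis using pM by blast
qed

text \<open>The third property, uniqueness of the decomposition, is the working tool: linearity
  here, and later every commutation rule for P, is proved by exhibiting the right candidate.\<close>

lemma orthogonal_projection_exists:
  fixes M :: "'a::{real_inner, complete_space} set"
  assumes M: "subspace M" "closed M"
  obtains P :: "'a \<Rightarrow>\<^sub>L 'a" where "\<And>x. P x \<in> M" "\<And>x z. z \<in> M \<Longrightarrow> inner (x - P x) z = 0"
    "\<And>x y. y \<in> M \<Longrightarrow> (\<And>z. z \<in> M \<Longrightarrow> inner (x - y) z = 0) \<Longrightarrow> P x = y"
proof -
  obtain p where p: "\<And>x. p x \<in> M" "\<And>x z. z \<in> M \<Longrightarrow> inner (x - p x) z = 0"
    using orthogonal_decomposition_exists[OF assms] by metis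
  have unique: "p x = y" if y: "y \<in> M" "\<And>z. z \<in> M \<Longrightarrow> inner (x - y) z = 0" for x y
  proof -
    have "p x - y \<in> M" using p(1) y(1) M(1) by (intro subspace_diff)
    from y(2)[OF this] p(2)[OF this, of x] have "inner (p x - y) (p x - y) = 0"
      by (simp add: inner_simps)
    then show ?thesis by simp
  qed
  have "bounded_linear p"
  proof (rule bounded_linear_intro[where K = 1])
    show "p (x + y) = p x + p y" for x y
    proof (rule unique)
      show "inner (x + y - (p x + p y)) z = 0" if "z \<in> M" for z
        using p(2)[OF that, of x] p(2)[OF that, of y] by (simp add: inner_simps)
    qed (use p M in \<open>auto intro: subspace_add\<close>)
    show "p (r *\<^sub>R x) = r *\<^sub>R p x" for r x
    proof (rule unique)
      show "inner (r *\<^sub>R x - r *\<^sub>R p x) z = 0" if "z \<in> M" for z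
        using p(2)[OF that, of x] by (simp add: scaleR_diff_right[symmetric])
    qed (use p M in \<open>auto intro: subspace_scale\<close>)
    show "norm (p x) \<le> norm x * 1" for x
    proof -
      have "(norm x)\<^sup>2 = (norm (p x))\<^sup>2 + (norm (x - p x))\<^sup>2"
        using p(2)[OF p(1), of x x] unfolding power2_norm_eq_inner
        by (simp add: inner_simps inner_commute)
      then have "(norm (p x))\<^sup>2 \<le> (norm x)\<^sup>2" by simp
      then show ?thesis
        by (simp add: abs_le_square_iff[symmetric])
    qed
  qed
  then show ?thesis
    using that[of "Blinfun p"] p unique by (simp add: bounded_linear_Blinfun_apply)
qed

definition projections :: "('a::chilbert_space \<Rightarrow>\<^sub>L 'a) set" where
  "projections = {p \<in> self_adjoint_ops. p o\<^sub>L p = p}"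

lemma projectionD:
  assumes "p \<in> projections"
  shows "p \<in> self_adjoint_ops" "p (p x) = p x" "inner x (p x) = (norm (p x))\<^sup>2"
proof -
  show "p \<in> self_adjoint_ops" and idem: "p (p x) = p x" for x
    using assms by (auto simp: projections_def) (metis blinfun_apply_blinfun_compose)
  then show "inner x (p x) = (norm (p x))\<^sup>2"
    using self_adjointD(2)[of p x "p x"] by (simp add: power2_norm_eq_inner)
qed

lemma projection_id_diff: "p \<in> projections \<Longrightarrow> id_blinfun - p \<in> projections"
  by (auto simp: projections_def blinfun.bilinear_simps projectionD(2) intro!: blinfun_eqI)

lemma projection_Pythagoras:
  assumes "p \<in> projections"
  shows "inner x x = (norm (p x))\<^sup>2 + (norm (x - p x))\<^sup>2"
  using projectionD(3)[OF assms, of x]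
  by (simp add: power2_norm_eq_inner inner_simps inner_commute)

lemma projection_effect: "p \<in> projections \<Longrightarrow> p \<in> effects"
  by (simp add: effects_iff projectionD projection_Pythagoras)

text \<open>Invariance of M under \<open>imult\<close> makes the real projection complex-linear. A
  self-adjoint T that preserves M also preserves its complement, which is why it commutes with
  p.\<close>

lemma projection_onto:
  fixes M :: "'a::chilbert_space set"
  assumes M: "subspace M" "closed M" and im: "\<And>x. x \<in> M \<Longrightarrow> imult x \<in> M"
  obtains p where "p \<in> projections" "\<And>x. p x \<in> M" "\<And>x z. z \<in> M \<Longrightarrow> inner (x - p x) z = 0"
    "\<And>T. T \<in> self_adjoint_ops \<Longrightarrow> (\<And>x. x \<in> M \<Longrightarrow> T x \<in> M) \<Longrightarrow> T o\<^sub>L p = p o\<^sub>L T"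
proof -
  obtain P :: "'a \<Rightarrow>\<^sub>L 'a" where P: "\<And>x. P x \<in> M" "\<And>x z. z \<in> M \<Longrightarrow> inner (x - P x) z = 0"
    "\<And>x y. y \<in> M \<Longrightarrow> (\<And>z. z \<in> M \<Longrightarrow> inner (x - y) z = 0) \<Longrightarrow> P x = y"
    using orthogonal_projection_exists[OF M] by metis
  have "P (imult x) = imult (P x)" for x
  proof (rule P(3))
    show "inner (imult x - imult (P x)) z = 0" if "z \<in> M" for z
      using P(2)[OF im[OF that], of x] by (simp add: imult_diff[symmetric] inner_imult_right)
  qed (use P im in auto)
  moreover have "inner (P x) y = inner x (P y)" for x y
    using P(2)[OF P(1), of x y] P(2)[OF P(1), of y x]
    by (simp add: inner_simps inner_commute)
  moreover have "P o\<^sub>L P = P"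
    by (intro blinfun_eqI) (auto intro!: P(3) P(1))
  ultimately have "P \<in> projections"
    by (simp add: projections_def self_adjoint_iff)
  moreover have "T o\<^sub>L P = P o\<^sub>L T"
    if T: "T \<in> self_adjoint_ops" and inv: "\<And>x. x \<in> M \<Longrightarrow> T x \<in> M" for T
    unfolding commute_iff
  proof
    fix x
    have "P (T x) = T (P x)"
    proof (rule P(3))
      show "inner (T x - T (P x)) z = 0" if "z \<in> M" for z
        using P(2)[OF inv[OF that], of x] self_adjointD(2)[OF T]
        by (simp add: blinfun.diff_right[symmetric])
    qed (use P inv in auto)
    then show "T (P x) = P (T x)" ..
  qed
  ultimately show ?thesis using that P(1,2) by blast
qed

section \<open>Dyadic approximation by operators with finite spectrum\<close>

text \<open>\<open>q\<close> is the spectral projection of \<open>a\<close> for \<open>{1/2<..}\<close>: with \<open>x = 2 a - 1\<close>, its complement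
  projects onto the kernel of \<open>\<bar>x\<bar> + x\<close>.\<close>

lemma spectral_halving:
  fixes a :: "'a::chilbert_space \<Rightarrow>\<^sub>L 'a"
  assumes a: "a \<in> effects"
  obtains q where "q \<in> projections" "2 *\<^sub>R a - q \<in> effects"
    "\<And>T. T \<in> self_adjoint_ops \<Longrightarrow> T o\<^sub>L a = a o\<^sub>L T \<Longrightarrow> T o\<^sub>L q = q o\<^sub>L T"
proof -
  define x where "x = 2 *\<^sub>R a - id_blinfun"
  have x: "x \<in> self_adjoint_ops"
    using a by (auto simp: x_def)
  note xs = self_adjointD[OF x]
  have xx: "x o\<^sub>L x \<in> effects"
    unfolding effects_iff
  proof (intro conjI allI)
    show "x o\<^sub>L x \<in> self_adjoint_ops"
      using x by (intro self_adjoint_compose) auto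
    fix v
    have eq: "inner v ((x o\<^sub>L x) v) = inner (x v) (x v)"
      by (simp add: xs(2))
    show "0 \<le> inner v ((x o\<^sub>L x) v)"
      unfolding eq by simp
    \<comment> \<open>In other words x^2 = 1 - 4 (a - a^2), so x^2 \<le> 1 amounts to a^2 \<le>
      a.\<close>
    have "inner (x v) (x v) = inner v v - 4 * inner v (a v) + 4 * (norm (a v))\<^sup>2"
      by (simp add: x_def blinfun.bilinear_simps inner_simps inner_commute
          power2_norm_eq_inner)
    then show "inner v ((x o\<^sub>L x) v) \<le> inner v v"
      using effect_norm_sq_le[OF a, of v] unfolding eq by simp
  qed
  define m where "m = op_sqrt (x o\<^sub>L x)"
  have m: "m \<in> self_adjoint_ops" "0 \<preceq> m" "m o\<^sub>L m = x o\<^sub>L x"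
    "\<And>T. T o\<^sub>L (x o\<^sub>L x) = (x o\<^sub>L x) o\<^sub>L T \<Longrightarrow> T o\<^sub>L m = m o\<^sub>L T"
    unfolding m_def by (fact op_sqrt[OF xx])+
  note ms = self_adjointD[OF m(1)]
  have mpos: "0 \<le> inner v (m v)" for v
    using m(2) by (simp add: op_le_iff)
  have mm: "m (m v) = x (x v)" for v
    using m(3) by (metis blinfun_apply_blinfun_compose)
  have xm: "x (m v) = m (x v)" for v
    using m(4)[of x] by (simp add: commute_iff)
  have Tm: "T (m v) = m (T v)" if "T o\<^sub>L a = a o\<^sub>L T" for T v
  proof -
    have "T (x v) = x (T v)" for v
      using that by (simp add: commute_iff x_def blinfun.bilinear_simps)
    then show ?thesis
      using m(4)[of T] by (simp add: commute_iff)
  qed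
  define M where "M = {v. (m + x) v = 0}"
  have M: "v \<in> M \<longleftrightarrow> m v + x v = 0" for v
    by (simp add: M_def blinfun.add_left)
  have "subspace M"
    by (auto simp: subspace_def M_def blinfun.bilinear_simps(2-))
  moreover have "closed M"
  proof -
    have "closed ((\<lambda>v. (m + x) v) -` {0})"
      by (intro continuous_closed_vimage) (auto intro: linear_continuous_at blinfun.bounded_linear_right)
    then show ?thesis by (simp add: M_def vimage_def)
  qed
  moreover have "imult v \<in> M" if "v \<in> M" for v
    using that by (simp add: M ms xs imult_add[symmetric])
  ultimately obtain p where p: "p \<in> projections" "\<And>v. p v \<in> M"
    "\<And>v z. z \<in> M \<Longrightarrow> inner (v - p v) z = 0"
    "\<And>T. T \<in> self_adjoint_ops \<Longrightarrow> (\<And>v. v \<in> M \<Longrightarrow> T v \<in> M) \<Longrightarrow> T o\<^sub>L p = p o\<^sub>L T"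
    using projection_onto by metis
  have pT: "T o\<^sub>L p = p o\<^sub>L T" if "T \<in> self_adjoint_ops" "T o\<^sub>L a = a o\<^sub>L T" for T
  proof (rule p(4))
    fix v assume "v \<in> M"
    then have "T (m v + x v) = 0" by (simp add: M)
    then show "T v \<in> M"
      using that(2) Tm[OF that(2)]
      by (simp add: M blinfun.add_right) (simp add: x_def commute_iff blinfun.bilinear_simps)
  qed fact
  have "x o\<^sub>L p = p o\<^sub>L x"
    using x by (rule pT[OF _]) (simp add: x_def commute_iff blinfun.bilinear_simps)
  then have xp: "x (p v) = p (x v)" for v
    by (simp add: commute_iff)
  have neg: "inner v (x v) \<le> 0" if "v \<in> M" for v
    using that mpos[of v] by (simp add: M add_eq_0_iff)
  have pos: "0 \<le> inner v (x v)" if "\<And>z. z \<in> M \<Longrightarrow> inner v z = 0" for v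
  proof -
    \<comment> \<open>Because (m + x) (m - x) = m^2 - x^2 = 0, the range of m - x lies in M. A
      vector v orthogonal to M is therefore killed by m - x, and x acts on it as the positive
      operator m.\<close>
    have ker: "m z - x z \<in> M" for z
      by (simp add: M blinfun.bilinear_simps mm xm)
    have "inner (m v - x v) (m v - x v) = inner v (m (m v - x v) - x (m v - x v))"
      by (simp add: inner_diff_left inner_diff_right ms xs blinfun.bilinear_simps)
    also have "\<dots> = 0"
      using that ker by blast
    finally have "m v = x v" by simp
    then show ?thesis using mpos[of v] by simp
  qed
  have "id_blinfun - p \<in> projections"
    using p(1) by (rule projection_id_diff)
  \<comment> \<open>The operator is x + p, and x commutes with p, so there are no cross terms. On
    the range of p, -1 \<le> x \<le> 0 is shifted up by 1; on the complement 0 \<le> x \<le> 1 is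
    kept.\<close>
  moreover have "2 *\<^sub>R a - (id_blinfun - p) \<in> effects"
  proof -
    have eq: "2 *\<^sub>R a - (id_blinfun - p) = x + p"
      by (simp add: x_def)
    have "x + p \<in> effects"
      unfolding effects_iff
    proof (intro conjI allI)
      show "x + p \<in> self_adjoint_ops"
        using x projectionD(1)[OF p(1)] by auto
      fix v
      let ?w = "v - p v"
      have w0: "inner ?w z = 0" if "z \<in> M" for z
        using p(3) that by blast
      have "x (p v) \<in> M" by (simp add: xp p(2))
      then have "inner ?w (x (p v)) = 0" "inner (p v) (x ?w) = 0"
        using w0 by (auto simp: xs(2)[symmetric] inner_commute)
      then have "inner v (x v) = inner ?w (x ?w) + inner (p v) (x (p v))"
        by (simp add: inner_diff_left inner_diff_right blinfun.bilinear_simps)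
      moreover have "inner v (p v) = inner (p v) (p v)"
        by (simp add: projectionD[OF p(1)] power2_norm_eq_inner)
      moreover have "inner v v = inner ?w ?w + inner (p v) (p v)"
        using projection_Pythagoras[OF p(1), of v] by (simp add: power2_norm_eq_inner)
      moreover have "0 \<le> inner ?w (x ?w)" "inner (p v) (x (p v)) \<le> 0"
        using pos w0 neg p(2) by blast+
      moreover have "inner ?w (x ?w) \<le> inner ?w ?w" "- inner (p v) (p v) \<le> inner (p v) (x (p v))"
        using effectD(3)[OF a, of ?w] effectD(2)[OF a, of "p v"]
        by (simp_all add: x_def blinfun.diff_left blinfun.scaleR_left inner_diff_right)
      ultimately show "0 \<le> inner v ((x + p) v)" "inner v ((x + p) v) \<le> inner v v"
        by (simp_all add: blinfun.add_left inner_add_right)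
    qed
    then show ?thesis by (simp add: eq)
  qed
  moreover have "T o\<^sub>L (id_blinfun - p) = (id_blinfun - p) o\<^sub>L T"
    if "T \<in> self_adjoint_ops" "T o\<^sub>L a = a o\<^sub>L T" for T
    using pT[OF that] by (simp add: commute_iff blinfun.bilinear_simps)
  ultimately show ?thesis using that by blast
qed

text \<open>The projection q is the leading binary digit of a, and 2 a - q carries the remaining
  digits, so each step halves the error. The commutation clause is part of the induction because it
  makes q commute with s: an eigenvector x of s then splits into q x and x - q x, which are
  eigenvectors of (q + s) / 2. The span is algebraic, without closure.\<close>

lemma dyadic_approximation:
  fixes a :: "'a::chilbert_space \<Rightarrow>\<^sub>L 'a"
  assumes "a \<in> effects"
  shows "\<exists>s\<in>effects. norm (a - s) \<le> (1/2) ^ n \<and>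
    (\<forall>T\<in>self_adjoint_ops. T o\<^sub>L a = a o\<^sub>L T \<longrightarrow> T o\<^sub>L s = s o\<^sub>L T) \<and>
    span {x. \<exists>l. s x = l *\<^sub>R x} = UNIV"
  using assms
proof (induction n arbitrary: a)
  case 0
  have "span {x. \<exists>l. blinfun_apply 0 x = l *\<^sub>R x} = (UNIV :: 'a set)"
    by (auto intro!: span_base exI[of _ 0])
  then show ?case
    using effect_norm_le[OF 0] by (intro bexI[of _ 0]) (auto simp: effect_zero)
next
  case (Suc n)
  obtain q where q: "q \<in> projections" "2 *\<^sub>R a - q \<in> effects"
    "\<And>T. T \<in> self_adjoint_ops \<Longrightarrow> T o\<^sub>L a = a o\<^sub>L T \<Longrightarrow> T o\<^sub>L q = q o\<^sub>L T"
    using spectral_halving[OF Suc.prems] by metis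
  let ?a = "2 *\<^sub>R a - q"
  obtain s where s: "s \<in> effects" "norm (?a - s) \<le> (1/2) ^ n"
    "\<And>T. T \<in> self_adjoint_ops \<Longrightarrow> T o\<^sub>L ?a = ?a o\<^sub>L T \<Longrightarrow> T o\<^sub>L s = s o\<^sub>L T"
    "span {x. \<exists>l. s x = l *\<^sub>R x} = UNIV"
    using Suc.IH[OF q(2)] by auto
  let ?s = "(1/2) *\<^sub>R (q + s)"
  note qe = projection_effect[OF q(1)]
  have "?s \<in> effects"
    using effectD[OF qe] effectD[OF s(1)]
    by (auto simp: effects_iff blinfun.bilinear_simps inner_simps intro: add_mono)
      (smt (verit) field_sum_of_halves)
  moreover have "norm (a - ?s) \<le> (1/2) ^ Suc n"
  proof -
    have "a - ?s = (1/2) *\<^sub>R (?a - s)"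
      by (simp add: algebra_simps scaleR_2[symmetric])
    then show ?thesis using s(2) by simp
  qed
  moreover have "T o\<^sub>L ?s = ?s o\<^sub>L T"
    if T: "T \<in> self_adjoint_ops" "T o\<^sub>L a = a o\<^sub>L T" for T
  proof -
    have "T o\<^sub>L ?a = ?a o\<^sub>L T"
      using T(2) q(3)[OF T] by (simp add: blinfun_compose_linear)
    then show ?thesis
      using q(3)[OF T] s(3)[OF T(1)] by (simp add: blinfun_compose_linear)
  qed
  moreover have "span {x. \<exists>l. ?s x = l *\<^sub>R x} = UNIV"
  proof -
    let ?E = "{x. \<exists>l. ?s x = l *\<^sub>R x}"
    have "a o\<^sub>L q = q o\<^sub>L a"
      using q(3)[of a] Suc.prems by auto
    then have "q o\<^sub>L ?a = ?a o\<^sub>L q"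
      by (simp add: blinfun_compose_linear)
    then have qs: "q (s x) = s (q x)" for x
      using s(3)[of q] projectionD(1)[OF q(1)] by (simp add: commute_iff)
    have eig: "x \<in> span ?E" if "s x = l *\<^sub>R x" for x l
    proof -
      have "s (q x) = l *\<^sub>R q x"
        using that qs[of x] by (simp add: blinfun.scaleR_right)
      moreover from this have "s (x - q x) = l *\<^sub>R (x - q x)"
        using that by (simp add: blinfun.diff_right scaleR_diff_right)
      ultimately have "?s (q x) = ((1 + l) / 2) *\<^sub>R q x" "?s (x - q x) = (l / 2) *\<^sub>R (x - q x)"
        by (simp_all add: blinfun.add_left blinfun.scaleR_left blinfun.diff_right
            projectionD[OF q(1)] algebra_simps add_divide_distrib)
      then have "q x \<in> span ?E" "x - q x \<in> span ?E"
        by (auto intro!: span_base)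
      then have "q x + (x - q x) \<in> span ?E"
        by (rule span_add)
      then show ?thesis by simp
    qed
    have "span {x. \<exists>l. s x = l *\<^sub>R x} \<subseteq> span ?E"
      by (rule span_minimal) (auto intro: eig)
    then show ?thesis using s(4) by auto
  qed
  ultimately show ?case by blast
qed

section \<open>Rank-one operators\<close>

definition ket_bra :: "'a::chilbert_space \<Rightarrow> 'a \<Rightarrow> 'a \<Rightarrow>\<^sub>L 'a" where
  "ket_bra u v = Blinfun (\<lambda>x. cinner v x *\<^sub>C u)"

lemma ket_bra_apply:
  "ket_bra u v x = inner v x *\<^sub>R u + inner (imult v) x *\<^sub>R imult u"
proof -
  have "(\<lambda>x. cinner v x *\<^sub>C u) = (\<lambda>x. inner v x *\<^sub>R u + inner (imult v) x *\<^sub>R imult u)"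
    by (simp add: scaleC_eq cinner_eq)
  moreover have "bounded_linear (\<lambda>x. inner v x *\<^sub>R u + inner (imult v) x *\<^sub>R imult u)"
    by (intro bounded_linear_intros)
  ultimately show ?thesis
    by (simp add: ket_bra_def bounded_linear_Blinfun_apply)
qed

lemma ket_bra_imult: "ket_bra u v (imult x) = imult (ket_bra u v x)"
  by (simp add: ket_bra_apply imult_add imult_scaleR inner_imult_right)

lemma ket_bra_adjoint: "inner (ket_bra u v x) y = inner x (ket_bra v u y)"
  using inner_commute[of u y] inner_commute[of "imult u" y] inner_commute[of x v]
    inner_commute[of x "imult v"]
  by (simp add: ket_bra_apply inner_add_left inner_add_right)

lemma ket_bra_self_adjoint: "ket_bra u u \<in> self_adjoint_ops"
  by (simp add: self_adjoint_iff ket_bra_imult ket_bra_adjoint)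

lemma ket_bra_sym_self_adjoint: "ket_bra u v + ket_bra v u \<in> self_adjoint_ops"
  by (simp add: self_adjoint_iff ket_bra_imult ket_bra_adjoint blinfun.add_left imult_add
      inner_add_left inner_add_right add.commute)

lemma self_adjoint_ket_bra:
  assumes "A \<in> self_adjoint_ops"
  shows "A (ket_bra u v x) = ket_bra (A u) v x" "ket_bra u v (A x) = ket_bra u (A v) x"
  by (simp_all add: ket_bra_apply blinfun.add_right blinfun.scaleR_right
      self_adjointD(1)[OF assms] self_adjointD(2)[OF assms, symmetric])

lemma ket_bra_ket_bra: "ket_bra u v (ket_bra w z x) = ket_bra (ket_bra u v w) z x"
  by (simp add: ket_bra_apply[of _ z] ket_bra_imult blinfun.bilinear_simps)

lemma ket_bra_linear_left:
  "ket_bra (u + v) z x = ket_bra u z x + ket_bra v z x"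
  "ket_bra (r *\<^sub>R u) z x = r *\<^sub>R ket_bra u z x"
  "ket_bra 0 z x = 0"
  by (simp_all add: ket_bra_apply imult_add imult_scaleR algebra_simps)

lemma ket_bra_projection: "norm e = 1 \<Longrightarrow> ket_bra e e \<in> projections"
  unfolding projections_def
  by (auto simp: ket_bra_self_adjoint ket_bra_apply norm_eq_1 inner_add_right inner_imult_right
      intro!: blinfun_eqI)

section \<open>Involutive symmetries\<close>

text \<open>These are the unitaries and antiunitaries of order two. Such a V is its own inverse and
  its own real adjoint, so A \<mapsto> V A V needs no adjoint operation, and V A V is complex-linear
  even for antilinear V.\<close>

definition involutive_symmetry :: "('a::chilbert_space \<Rightarrow>\<^sub>L 'a) \<Rightarrow> bool" where
  "involutive_symmetry V \<longleftrightarrow> (\<forall>x. V (V x) = x) \<and> (\<forall>x y. inner (V x) (V y) = inner x y) \<and>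
    ((\<forall>x. V (imult x) = imult (V x)) \<or> (\<forall>x. V (imult x) = - imult (V x)))"

text \<open>A maximal set \<open>K\<close> on which \<open>cinner\<close> is real is a closed real subspace and the real
  orthogonal complement of \<open>\<i> K\<close>, so that the reflection in \<open>K\<close> is antilinear.\<close>

lemma conjugation_exists:
  fixes e f :: "'a::chilbert_space"
  assumes "inner (imult e) f = 0"
  obtains C :: "'a \<Rightarrow>\<^sub>L 'a" where "involutive_symmetry C"
    "\<And>x. C (imult x) = - imult (C x)" "C e = e" "C f = f"
proof -
  define \<A> where "\<A> = {K :: 'a set. {e, f} \<subseteq> K \<and> (\<forall>x\<in>K. \<forall>y\<in>K. inner (imult x) y = 0)}"
  have "inner (imult f) e = 0"
    using assms by (metis inner_commute inner_imult_right minus_equation_iff minus_zero)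
  then have base: "{e, f} \<in> \<A>"
    using assms by (auto simp: \<A>_def)
  have "\<exists>K\<in>\<A>. \<forall>X\<in>\<A>. K \<subseteq> X \<longrightarrow> X = K"
  proof (rule subset_Zorn_nonempty)
    show "\<A> \<noteq> {}" using base by blast
    fix \<C> assume \<C>: "\<C> \<noteq> {}" "subset.chain \<A> \<C>"
    have "inner (imult x) y = 0" if xy: "x \<in> \<Union>\<C>" "y \<in> \<Union>\<C>" for x y
    proof -
      obtain X Y where XY: "X \<in> \<C>" "Y \<in> \<C>" "x \<in> X" "y \<in> Y" using xy by blast
      then have "X \<subseteq> Y \<or> Y \<subseteq> X"
        using \<C>(2) by (auto simp: subset_chain_def)
      then have "X \<union> Y \<in> \<C>"
        using XY(1,2) by (auto simp: sup.absorb1 sup.absorb2)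
      then have "X \<union> Y \<in> \<A>"
        using \<C>(2) by (auto simp: subset_chain_def)
      then show ?thesis
        using XY unfolding \<A>_def by blast
    qed
    moreover have "{e, f} \<subseteq> \<Union>\<C>"
    proof -
      obtain X where "X \<in> \<C>" using \<C>(1) by blast
      moreover from this have "X \<in> \<A>"
        using \<C>(2) by (auto simp: subset_chain_def)
      ultimately show ?thesis by (auto simp: \<A>_def)
    qed
    ultimately show "\<Union>\<C> \<in> \<A>"
      unfolding \<A>_def by blast
  qed
  then obtain K where K: "K \<in> \<A>" "\<And>X. X \<in> \<A> \<Longrightarrow> K \<subseteq> X \<Longrightarrow> X = K" by blast
  have KD: "inner (imult y) w = 0" if "w \<in> K" "y \<in> K" for w y
    using K(1) that by (auto simp: \<A>_def)
  \<comment> \<open>By maximality, any w that could be adjoined to K already lies in it.\<close>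
  have KI: "w \<in> K" if w: "\<And>y. y \<in> K \<Longrightarrow> inner (imult y) w = 0" for w
  proof -
    from w have "\<forall>y\<in>K. inner (imult w) y = 0"
      by (metis inner_commute inner_imult_right minus_zero)
    then have "insert w K \<in> \<A>"
      using K(1) w by (auto simp: \<A>_def)
    from K(2)[OF this] show "w \<in> K" by blast
  qed
  have "subspace K"
  proof (rule subspaceI)
    show "0 \<in> K" by (rule KI) simp
    show "x + y \<in> K" if "x \<in> K" "y \<in> K" for x y
      using KD that by (intro KI) (simp add: inner_add_right)
    show "r *\<^sub>R x \<in> K" if "x \<in> K" for r x
      using KD that by (intro KI) simp
  qed
  moreover have "closed K"
  proof -
    have "K = (\<Inter>y\<in>K. {w. inner (imult y) w = 0})"
      using KI KD by blast
    moreover have "closed {w. inner (imult y) w = 0}" for y :: 'a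
      by (intro closed_Collect_eq continuous_intros)
    ultimately show ?thesis
      by (metis (no_types, lifting) closed_INT)
  qed
  ultimately obtain P :: "'a \<Rightarrow>\<^sub>L 'a" where P: "\<And>x. P x \<in> K"
    "\<And>x z. z \<in> K \<Longrightarrow> inner (x - P x) z = 0"
    "\<And>x y. y \<in> K \<Longrightarrow> (\<And>z. z \<in> K \<Longrightarrow> inner (x - y) z = 0) \<Longrightarrow> P x = y"
    using orthogonal_projection_exists by metis
  have PK: "P x = x" if "x \<in> K" for x
    using that by (intro P(3)) auto
  have Psym: "inner (P x) y = inner x (P y)" for x y
    using P(2)[OF P(1), of x y] P(2)[OF P(1), of y x]
    by (simp add: inner_simps inner_commute)
  \<comment> \<open>Since x - P x is orthogonal to K, i (x - P x) lies in K, while i P x is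
    orthogonal to K. So P turns i x into i (x - P x), and this is what makes 2 P - 1
    antilinear.\<close>
  have Pi: "P (imult x) = imult (x - P x)" for x
  proof (rule P(3))
    show "imult (x - P x) \<in> K"
      using P(2) by (intro KI) (simp add: inner_commute)
    have "imult x - imult (x - P x) = imult (P x)"
      by (simp add: imult_diff)
    then show "inner (imult x - imult (x - P x)) z = 0" if "z \<in> K" for z
      using KD[OF that P(1)] by simp
  qed
  define C where "C = 2 *\<^sub>R P - id_blinfun"
  have C: "C x = 2 *\<^sub>R P x - x" for x
    by (simp add: C_def blinfun.bilinear_simps)
  have CC: "C (C x) = x" for x
    by (simp add: C blinfun.bilinear_simps PK P(1) scaleR_2)
  have Ciso: "inner (C x) (C y) = inner x y" for x y
  proof -
    have "inner (C x) (C y) = inner x (C (C y))"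
      by (simp add: C inner_diff_left inner_diff_right Psym blinfun.diff_right blinfun.scaleR_right)
    then show ?thesis by (simp add: CC)
  qed
  have Ci: "C (imult x) = - imult (C x)" for x
    by (simp add: C Pi imult_diff imult_add scaleR_2)
  show ?thesis
  proof
    show "involutive_symmetry C"
      by (simp add: involutive_symmetry_def CC Ciso Ci)
    show "C (imult x) = - imult (C x)" for x by (rule Ci)
    have "e \<in> K" "f \<in> K" using K(1) by (auto simp: \<A>_def)
    then show "C e = e" "C f = f" by (auto simp: C PK scaleR_2)
  qed
qed

lemma involutive_symmetryD:
  assumes "involutive_symmetry V"
  shows "V (V x) = x" "inner (V x) y = inner x (V y)"
  using assms unfolding involutive_symmetry_def by metis+

lemma involutive_symmetry_self_adjoint:
  assumes V: "involutive_symmetry V" and A: "A \<in> self_adjoint_ops"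
  shows "V o\<^sub>L A o\<^sub>L V \<in> self_adjoint_ops"
  using V self_adjointD[OF A] involutive_symmetryD(2)[OF V]
  by (auto simp: self_adjoint_iff involutive_symmetry_def blinfun.minus_right imult_minus)

lemma involutive_symmetry_effect:
  assumes V: "involutive_symmetry V" and b: "b \<in> effects"
  shows "V o\<^sub>L b o\<^sub>L V \<in> effects"
  unfolding effects_iff
proof (intro conjI allI)
  fix x
  have "inner x ((V o\<^sub>L b o\<^sub>L V) x) = inner (V x) (b (V x))"
    by (simp add: involutive_symmetryD(2)[OF V])
  moreover have "inner (V x) (V x) = inner x x"
    using V by (simp add: involutive_symmetry_def)
  ultimately show "0 \<le> inner x ((V o\<^sub>L b o\<^sub>L V) x)" "inner x ((V o\<^sub>L b o\<^sub>L V) x) \<le> inner x x"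
    using effectD(2,3)[OF b, of "V x"] by simp_all
qed (use V b in \<open>auto intro: involutive_symmetry_self_adjoint\<close>)

lemma involutive_symmetry_unital_order_iso:
  assumes V: "involutive_symmetry V"
  shows "unital_order_iso (\<lambda>A. V o\<^sub>L A o\<^sub>L V)"
proof -
  let ?\<Phi> = "\<lambda>A. V o\<^sub>L A o\<^sub>L V"
  note inv = involutive_symmetryD[OF V]
  have inv\<Phi>: "?\<Phi> (?\<Phi> A) = A" for A
    by (rule blinfun_eqI) (simp add: inv)
  have pos: "0 \<preceq> ?\<Phi> A" if "0 \<preceq> A" for A
    using that by (simp add: op_le_iff inv(2)[symmetric])
  have "bij_betw ?\<Phi> self_adjoint_ops self_adjoint_ops"
    by (rule bij_betwI[where g = ?\<Phi>]) (auto intro: involutive_symmetry_self_adjoint[OF V] simp: inv\<Phi>)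
  moreover have "?\<Phi> id_blinfun = id_blinfun"
    by (rule blinfun_eqI) (simp add: inv)
  moreover have "0 \<preceq> A \<longleftrightarrow> 0 \<preceq> ?\<Phi> A" for A
    using pos[of A] pos[of "?\<Phi> A"] by (auto simp only: inv\<Phi>)
  ultimately show ?thesis
    by (simp add: unital_order_iso_def blinfun_compose_linear)
qed

section \<open>Linear extension of additive maps on effects\<close>

text \<open>Nonnegativity stands in for continuity: it makes g monotone, so g t is squeezed between
  the values at neighbouring multiples of 1/n, where additivity alone determines g.\<close>

lemma additive_unit_interval:
  fixes g :: "real \<Rightarrow> real"
  assumes add: "\<And>s t. 0 \<le> s \<Longrightarrow> 0 \<le> t \<Longrightarrow> s + t \<le> 1 \<Longrightarrow> g (s + t) = g s + g t"
    and nonneg: "\<And>t. 0 \<le> t \<Longrightarrow> t \<le> 1 \<Longrightarrow> 0 \<le> g t"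
    and t: "0 \<le> t" "t \<le> 1"
  shows "g t = t * g 1"
proof -
  have mono: "g s \<le> g u" if "0 \<le> s" "s \<le> u" "u \<le> 1" for s u
    using add[of s "u - s"] nonneg[of "u - s"] that by simp
  have g0: "g 0 = 0"
    using add[of 0 0] by simp
  have frac: "g (real k / real n) = real k * g (1 / real n)" if "k \<le> n" "n > 0" for k n :: nat
    using that
  proof (induction k)
    case (Suc k)
    then have "real k / real n + 1 / real n \<le> 1"
      by (simp add: field_simps)
    then show ?case
      using Suc add[of "real k / real n" "1 / real n"] by (simp add: field_simps)
  qed (simp add: g0)
  have frac': "g (real k / real n) = real k / real n * g 1" if "k \<le> n" "n > 0" for k n :: nat
    using frac[OF that] frac[of n n] that by simp
  have bound: "\<bar>g t - t * g 1\<bar> \<le> g 1 / real n" if n: "n > 0" for n :: nat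
  \<comment> \<open>The case t < 1 ensures k + 1 \<le> n, so the upper grid point stays inside the
    interval where g is controlled.\<close>
  proof (cases "t = 1")
    case False
    define k where "k = nat \<lfloor>t * real n\<rfloor>"
    have k: "real k \<le> t * real n" "t * real n < real k + 1"
      using t by (auto simp: k_def)
    have "t * real n < real n"
      using t False n by simp
    then have kn: "Suc k \<le> n"
      using k(1) by linarith
    have lo: "real k / real n \<le> t" and hi: "t \<le> real (Suc k) / real n"
      using k n by (simp_all add: field_simps)
    have "real (Suc k) / real n \<le> 1" using kn n by simp
    then have "real k / real n * g 1 \<le> g t" "g t \<le> real (Suc k) / real n * g 1"
      using mono[of "real k / real n" t] mono[of t "real (Suc k) / real n"] lo hi t
        frac'[of k n] frac'[of "Suc k" n] kn n by simp_all
    moreover have "real k / real n * g 1 \<le> t * g 1" "t * g 1 \<le> real (Suc k) / real n * g 1"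
      using mult_right_mono[OF lo nonneg[of 1]] mult_right_mono[OF hi nonneg[of 1]] by simp_all
    moreover have "real (Suc k) / real n * g 1 = real k / real n * g 1 + g 1 / real n"
      by (simp add: add_divide_distrib algebra_simps)
    ultimately show ?thesis by linarith
  qed (use nonneg[of 1] in simp)
  have "\<bar>g t - t * g 1\<bar> \<le> 0"
  proof (rule LIMSEQ_le_const)
    show "(\<lambda>n. g 1 / real (Suc n)) \<longlonglongrightarrow> 0"
      by (intro LIMSEQ_Suc lim_const_over_n)
  qed (use bound in blast)
  then show ?thesis by simp
qed

lemma effect_combination:
  assumes "b \<in> effects" "c \<in> effects" "0 \<le> s" "0 \<le> t" "s + t \<le> N" "0 < N"
  shows "(1/N) *\<^sub>R (s *\<^sub>R b + t *\<^sub>R c) \<in> effects"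
  unfolding effects_iff
proof (intro conjI allI)
  show "(1/N) *\<^sub>R (s *\<^sub>R b + t *\<^sub>R c) \<in> self_adjoint_ops"
    using assms by auto
  fix x
  have eq: "inner x (((1/N) *\<^sub>R (s *\<^sub>R b + t *\<^sub>R c)) x) = (s * inner x (b x) + t * inner x (c x)) / N"
    by (simp add: blinfun.bilinear_simps inner_add_right)
  show "0 \<le> inner x (((1/N) *\<^sub>R (s *\<^sub>R b + t *\<^sub>R c)) x)"
    unfolding eq using assms by (simp add: effectD)
  have "s * inner x (b x) + t * inner x (c x) \<le> s * inner x x + t * inner x x"
    using assms by (intro add_mono mult_left_mono) (auto simp: effectD)
  also have "\<dots> \<le> N * inner x x"
    using assms(5) by (metis distrib_right inner_ge_zero mult_right_mono)
  finally show "inner x (((1/N) *\<^sub>R (s *\<^sub>R b + t *\<^sub>R c)) x) \<le> inner x x"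
    unfolding eq using assms(6) by (simp add: divide_le_eq mult.commute)
qed

text \<open>Up to scaling, v is the difference of v + \<open>norm v\<close> and
  \<open>norm v\<close> times the identity. The last clause, a single term for positive v, is what
  gives positivity of the extension.\<close>

lemma self_adjoint_effect_decomposition:
  assumes "v \<in> self_adjoint_ops"
  obtains s t b c where "0 \<le> s" "0 \<le> t" "b \<in> effects" "c \<in> effects" "v = s *\<^sub>R b - t *\<^sub>R c"
    "0 \<preceq> v \<Longrightarrow> t = 0"
proof (cases "0 \<preceq> v")
  case True
  have "(1 / (norm v + 1)) *\<^sub>R v \<in> effects"
    unfolding effects_iff
  proof (intro conjI allI)
    fix x
    show "0 \<le> inner x (((1 / (norm v + 1)) *\<^sub>R v) x)"
      using True by (simp add: op_le_iff blinfun.scaleR_left)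
    have "inner x (v x) \<le> (norm v + 1) * inner x x"
      using inner_le_norm[of x v] by (simp add: distrib_right) (smt (verit) inner_ge_zero)
    then show "inner x (((1 / (norm v + 1)) *\<^sub>R v) x) \<le> inner x x"
      by (simp add: blinfun.scaleR_left divide_le_eq mult.commute add_nonneg_pos)
  qed (use assms in auto)
  then show ?thesis
    using that[of "norm v + 1" 0 "(1 / (norm v + 1)) *\<^sub>R v" 0] effect_zero
      norm_ge_zero[of v] by (smt (verit) diff_zero divide_inverse mult_1 right_inverse
        scaleR_one scaleR_scaleR scaleR_zero_left)
next
  case False
  define N where "N = 2 * norm v + 1"
  have N: "N > 0" by (simp add: N_def add_nonneg_pos)
  let ?b = "(1/N) *\<^sub>R (v + norm v *\<^sub>R id_blinfun)"
  have "?b \<in> effects"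
    unfolding effects_iff
  proof (intro conjI allI)
    show "?b \<in> self_adjoint_ops" using assms by auto
    fix x
    have eq: "inner x (?b x) = (inner x (v x) + norm v * inner x x) / N"
      by (simp add: blinfun.bilinear_simps inner_add_right)
    show "0 \<le> inner x (?b x)"
      unfolding eq using inner_le_norm[of x v] N by simp
    have "inner x (v x) + norm v * inner x x \<le> N * inner x x"
      using inner_le_norm[of x v] by (simp add: N_def algebra_simps) (smt (verit) inner_ge_zero)
    then show "inner x (?b x) \<le> inner x x"
      unfolding eq using N by (simp add: divide_le_eq mult.commute)
  qed
  then show ?thesis
    using that[of N "norm v" ?b id_blinfun] effect_id N False by simp
qed

text \<open>Real homogeneity of F follows from \<open>additive_unit_interval\<close>, applied to the
  quadratic form at each vector. For well-definedness, two representations of v are rearranged into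
  an equation between sums with nonnegative coefficients and scaled down until both sides are
  effects, where F is additive.\<close>

lemma effect_additive_extension:
  fixes F :: "('a::chilbert_space \<Rightarrow>\<^sub>L 'a) \<Rightarrow> ('a \<Rightarrow>\<^sub>L 'a)"
  assumes eff: "\<And>b. b \<in> effects \<Longrightarrow> F b \<in> effects"
    and add: "\<And>b c. b \<in> effects \<Longrightarrow> c \<in> effects \<Longrightarrow> b + c \<preceq> id_blinfun \<Longrightarrow> F (b + c) = F b + F c"
  shows "\<exists>L. (\<forall>s t b c. 0 \<le> s \<longrightarrow> 0 \<le> t \<longrightarrow> b \<in> effects \<longrightarrow> c \<in> effects \<longrightarrow>
      L (s *\<^sub>R b - t *\<^sub>R c) = s *\<^sub>R F b - t *\<^sub>R F c)"
proof -
  have homog: "F (t *\<^sub>R b) = t *\<^sub>R F b" if b: "b \<in> effects" and t: "0 \<le> t" "t \<le> 1" for t b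
  proof (rule self_adjoint_eqI)
    have tb: "t *\<^sub>R b \<in> effects" if "0 \<le> t" "t \<le> 1" for t
      using effect_combination[OF b b, of t 0 1] that by simp
    show "F (t *\<^sub>R b) \<in> self_adjoint_ops" "t *\<^sub>R F b \<in> self_adjoint_ops"
      using eff tb[OF t] eff[OF b] by auto
    fix x
    define g where "g u = inner x (F (u *\<^sub>R b) x)" for u
    have "g t = t * g 1"
    proof (rule additive_unit_interval[OF _ _ t])
      show "g (u + w) = g u + g w" if "0 \<le> u" "0 \<le> w" "u + w \<le> 1" for u w
      proof -
        have "u *\<^sub>R b + w *\<^sub>R b \<preceq> id_blinfun"
          using tb[of "u + w"] that by (simp add: effects_def scaleR_add_left)
        then show ?thesis
          using add[of "u *\<^sub>R b" "w *\<^sub>R b"] tb that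
          by (simp add: g_def scaleR_add_left blinfun.add_left inner_add_right)
      qed
      show "0 \<le> g u" if "0 \<le> u" "u \<le> 1" for u
        using effectD(2)[OF eff[OF tb[OF that]]] by (simp add: g_def)
    qed
    then show "inner x (F (t *\<^sub>R b) x) = inner x ((t *\<^sub>R F b) x)"
      by (simp add: g_def blinfun.scaleR_left)
  qed
  have comb: "F ((1/N) *\<^sub>R (s *\<^sub>R b + t *\<^sub>R c)) = (1/N) *\<^sub>R (s *\<^sub>R F b + t *\<^sub>R F c)"
    if "b \<in> effects" "c \<in> effects" "0 \<le> s" "0 \<le> t" "s + t \<le> N" "0 < N" for b c s t N
  proof -
    have eq: "(1/N) *\<^sub>R (s *\<^sub>R b + t *\<^sub>R c) = (s/N) *\<^sub>R b + (t/N) *\<^sub>R c" for b c :: "'a \<Rightarrow>\<^sub>L 'a"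
      by (simp add: scaleR_add_right)
    have st: "0 \<le> s/N" "s/N \<le> 1" "0 \<le> t/N" "t/N \<le> 1"
      using that by simp_all
    have "(s/N) *\<^sub>R b \<in> effects" "(t/N) *\<^sub>R c \<in> effects"
      using effect_combination[OF that(1) that(1), of "s/N" 0 1]
        effect_combination[OF that(2) that(2), of "t/N" 0 1] st by simp_all
    moreover have "(s/N) *\<^sub>R b + (t/N) *\<^sub>R c \<preceq> id_blinfun"
      using effect_combination[OF that] by (simp add: effects_def eq)
    ultimately show ?thesis
      unfolding eq using add homog that(1,2) st by simp
  qed
  define R where "R v w \<longleftrightarrow> (\<exists>s t b c. 0 \<le> s \<and> 0 \<le> t \<and> b \<in> effects \<and> c \<in> effects \<and>
    v = s *\<^sub>R b - t *\<^sub>R c \<and> w = s *\<^sub>R F b - t *\<^sub>R F c)" for v w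
  have unique: "w = w'" if "R v w" "R v w'" for v w w'
  proof -
    obtain s t b c where 1: "0 \<le> s" "0 \<le> t" "b \<in> effects" "c \<in> effects"
      "v = s *\<^sub>R b - t *\<^sub>R c" "w = s *\<^sub>R F b - t *\<^sub>R F c"
      using \<open>R v w\<close> unfolding R_def by blast
    obtain s' t' b' c' where 2: "0 \<le> s'" "0 \<le> t'" "b' \<in> effects" "c' \<in> effects"
      "v = s' *\<^sub>R b' - t' *\<^sub>R c'" "w' = s' *\<^sub>R F b' - t' *\<^sub>R F c'"
      using \<open>R v w'\<close> unfolding R_def by blast
    \<comment> \<open>N bounds both s + t' and s' + t, the coefficient sums on the two sides of the
      rearranged equation.\<close>
    define N where "N = s + t + s' + t' + 1"
    have N: "s + t' \<le> N" "s' + t \<le> N" "0 < N"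
      using 1 2 by (auto simp: N_def)
    have eq: "s *\<^sub>R b + t' *\<^sub>R c' = s' *\<^sub>R b' + t *\<^sub>R c"
      using 1(5) 2(5) by (simp add: algebra_simps)
    have "(1/N) *\<^sub>R (s *\<^sub>R F b + t' *\<^sub>R F c') = (1/N) *\<^sub>R (s' *\<^sub>R F b' + t *\<^sub>R F c)"
      using comb[of b c' s t' N] comb[of b' c s' t N] 1 2 N by (simp add: eq)
    then have "s *\<^sub>R F b + t' *\<^sub>R F c' = s' *\<^sub>R F b' + t *\<^sub>R F c"
      using N(3) by simp
    then have "s *\<^sub>R F b = s' *\<^sub>R F b' + t *\<^sub>R F c - t' *\<^sub>R F c'"
      by (simp add: eq_diff_eq)
    then show ?thesis
      using 1(6) 2(6) by simp
  qed
  have "(THE w. R (s *\<^sub>R b - t *\<^sub>R c) w) = s *\<^sub>R F b - t *\<^sub>R F c"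
    if "0 \<le> s" "0 \<le> t" "b \<in> effects" "c \<in> effects" for s t b c
  proof (rule the_equality)
    show *: "R (s *\<^sub>R b - t *\<^sub>R c) (s *\<^sub>R F b - t *\<^sub>R F c)"
      using that unfolding R_def by blast
    show "w = s *\<^sub>R F b - t *\<^sub>R F c" if "R (s *\<^sub>R b - t *\<^sub>R c) w" for w
      using unique[OF that *] .
  qed
  then show ?thesis
    by (intro exI[of _ "\<lambda>v. THE w. R v w"]) simp
qed

section \<open>Sequential products\<close>

locale seq_product =
  fixes sp :: "('a::chilbert_space \<Rightarrow>\<^sub>L 'a) \<Rightarrow> ('a \<Rightarrow>\<^sub>L 'a) \<Rightarrow> ('a \<Rightarrow>\<^sub>L 'a)"
  assumes seq: "sequential_product sp"
begin

lemma sp_effect: "a \<in> effects \<Longrightarrow> b \<in> effects \<Longrightarrow> sp a b \<in> effects"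
  and sp_add: "a \<in> effects \<Longrightarrow> b \<in> effects \<Longrightarrow> c \<in> effects \<Longrightarrow> b + c \<preceq> id_blinfun \<Longrightarrow>
    sp a (b + c) = sp a b + sp a c"
  and sp_id_left: "a \<in> effects \<Longrightarrow> sp id_blinfun a = a"
  and sp_zero_sym: "a \<in> effects \<Longrightarrow> b \<in> effects \<Longrightarrow> sp a b = 0 \<Longrightarrow> sp b a = 0"
  using seq by (auto simp: sequential_product_def)

lemma sp_commute_compl: "a \<in> effects \<Longrightarrow> b \<in> effects \<Longrightarrow> sp a b = sp b a \<Longrightarrow>
    sp a (id_blinfun - b) = sp (id_blinfun - b) a"
  and sp_assoc: "a \<in> effects \<Longrightarrow> b \<in> effects \<Longrightarrow> c \<in> effects \<Longrightarrow> sp a b = sp b a \<Longrightarrow>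
    sp a (sp b c) = sp (sp a b) c"
  using seq unfolding sequential_product_def seq_commute_def by blast+

lemma sp_commute_add: "a \<in> effects \<Longrightarrow> b \<in> effects \<Longrightarrow> c \<in> effects \<Longrightarrow> sp c a = sp a c \<Longrightarrow>
    sp c b = sp b c \<Longrightarrow> a + b \<preceq> id_blinfun \<Longrightarrow> sp c (a + b) = sp (a + b) c"
  using seq unfolding sequential_product_def seq_commute_def by blast

text \<open>The real-linear extension of \<open>sp a\<close> to self-adjoint operators;
  \<open>effect_additive_extension\<close> provides it, and its values elsewhere are arbitrary. It
  is needed because off-diagonal operators are not effects.\<close>

definition ext :: "('a \<Rightarrow>\<^sub>L 'a) \<Rightarrow> ('a \<Rightarrow>\<^sub>L 'a) \<Rightarrow> ('a \<Rightarrow>\<^sub>L 'a)" where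
  "ext a = (SOME L. \<forall>s t b c. 0 \<le> s \<longrightarrow> 0 \<le> t \<longrightarrow> b \<in> effects \<longrightarrow> c \<in> effects \<longrightarrow>
      L (s *\<^sub>R b - t *\<^sub>R c) = s *\<^sub>R sp a b - t *\<^sub>R sp a c)"

lemma ext_eq:
  assumes "a \<in> effects" "0 \<le> s" "0 \<le> t" "b \<in> effects" "c \<in> effects"
  shows "ext a (s *\<^sub>R b - t *\<^sub>R c) = s *\<^sub>R sp a b - t *\<^sub>R sp a c"
  using someI_ex[OF effect_additive_extension[of "sp a"], folded ext_def] sp_effect sp_add assms
  by blast

lemma sp_zero_right: "a \<in> effects \<Longrightarrow> sp a 0 = 0"
  using sp_add[of a 0 0] by (simp add: effect_zero op_le_iff)

text \<open>From a \<circ> 0 = 0, axiom (3) gives 0 \<circ> a = 0. So a commutes with 0, hence by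
  axiom (4) with its complement 1, and axiom (2) finishes.\<close>

lemma sp_id_right: "a \<in> effects \<Longrightarrow> sp a id_blinfun = a"
  using sp_commute_compl[of a 0] sp_zero_right[of a] sp_zero_sym[of a 0] sp_id_left[of a]
  by (simp add: effect_zero)

lemma ext_effect: "a \<in> effects \<Longrightarrow> b \<in> effects \<Longrightarrow> ext a b = sp a b"
  using ext_eq[of a 1 0 b 0] by (simp add: effect_zero)

lemma ext_self_adjoint:
  assumes "a \<in> effects" "v \<in> self_adjoint_ops"
  shows "ext a v \<in> self_adjoint_ops"
proof -
  obtain s t b c where "0 \<le> s" "0 \<le> t" "b \<in> effects" "c \<in> effects" "v = s *\<^sub>R b - t *\<^sub>R c"
    using self_adjoint_effect_decomposition[OF assms(2)] by metis
  then show ?thesis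
    using ext_eq[OF assms(1)] sp_effect[OF assms(1)]
    by (auto intro!: self_adjoint_diff self_adjoint_scaleR)
qed

lemma ext_pos:
  assumes "a \<in> effects" "v \<in> self_adjoint_ops" "0 \<preceq> v"
  shows "0 \<preceq> ext a v"
proof -
  obtain s t b c where d: "0 \<le> s" "0 \<le> t" "b \<in> effects" "c \<in> effects" "v = s *\<^sub>R b - t *\<^sub>R c" "t = 0"
    using self_adjoint_effect_decomposition[OF assms(2)] assms(3) by metis
  then have "ext a v = s *\<^sub>R sp a b"
    using ext_eq[OF assms(1) d(1-4)] by simp
  then show ?thesis
    using effectD(2)[OF sp_effect[OF assms(1) d(3)]] d(1)
    by (simp add: op_le_iff blinfun.scaleR_left)
qed

text \<open>\<open>ext_eq\<close> evaluates only a difference of two multiples of effects. The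
  positive parts of v and w are therefore merged into one multiple N d, the negative parts into N'
  d'.\<close>

lemma ext_add:
  assumes a: "a \<in> effects" and v: "v \<in> self_adjoint_ops" and w: "w \<in> self_adjoint_ops"
  shows "ext a (v + w) = ext a v + ext a w"
proof -
  obtain s t b c where 1: "0 \<le> s" "0 \<le> t" "b \<in> effects" "c \<in> effects" "v = s *\<^sub>R b - t *\<^sub>R c"
    using self_adjoint_effect_decomposition[OF v] by metis
  obtain s' t' b' c' where 2: "0 \<le> s'" "0 \<le> t'" "b' \<in> effects" "c' \<in> effects"
    "w = s' *\<^sub>R b' - t' *\<^sub>R c'"
    using self_adjoint_effect_decomposition[OF w] by metis
  have comb: "\<exists>N d. 0 \<le> N \<and> d \<in> effects \<and> N *\<^sub>R d = s *\<^sub>R b + s' *\<^sub>R b' \<and>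
      N *\<^sub>R sp a d = s *\<^sub>R sp a b + s' *\<^sub>R sp a b'"
    if "0 \<le> s" "0 \<le> s'" "b \<in> effects" "b' \<in> effects" for s s' b b'
  proof -
    define N where "N = s + s' + 1"
    have N: "N > 0" "s + s' \<le> N" using that by (auto simp: N_def)
    have sc: "x *\<^sub>R y \<in> effects" if "y \<in> effects" "0 \<le> x" "x \<le> 1" for x y
      using effect_combination[OF that(1) that(1), of x 0 1] that by simp
    have hom: "sp a (x *\<^sub>R y) = x *\<^sub>R sp a y" if "y \<in> effects" "0 \<le> x" "x \<le> 1" for x y
      using ext_eq[OF a that(2) order_refl that(1) effect_zero] ext_effect[OF a sc[OF that]] by simp
    let ?d = "(1/N) *\<^sub>R (s *\<^sub>R b + s' *\<^sub>R b')"
    have d: "?d \<in> effects"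
      using that N by (intro effect_combination) auto
    have d': "?d = (s/N) *\<^sub>R b + (s'/N) *\<^sub>R b'"
      by (simp add: scaleR_add_right)
    have st: "0 \<le> s/N" "s/N \<le> 1" "0 \<le> s'/N" "s'/N \<le> 1"
      using N that by (simp_all add: N_def)
    have "sp a ?d = (s/N) *\<^sub>R sp a b + (s'/N) *\<^sub>R sp a b'"
      unfolding d'
      by (subst sp_add) (use a sc hom st that d in \<open>auto simp: effects_def d'\<close>)
    then have "N *\<^sub>R sp a ?d = s *\<^sub>R sp a b + s' *\<^sub>R sp a b'"
      using N by (simp add: scaleR_add_right)
    then show ?thesis
      using N d by (intro exI[of _ N] exI[of _ ?d]) simp
  qed
  obtain N d where N: "0 \<le> N" "d \<in> effects" "N *\<^sub>R d = s *\<^sub>R b + s' *\<^sub>R b'"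
    "N *\<^sub>R sp a d = s *\<^sub>R sp a b + s' *\<^sub>R sp a b'"
    using comb[OF 1(1) 2(1) 1(3) 2(3)] by blast
  obtain N' d' where N': "0 \<le> N'" "d' \<in> effects" "N' *\<^sub>R d' = t *\<^sub>R c + t' *\<^sub>R c'"
    "N' *\<^sub>R sp a d' = t *\<^sub>R sp a c + t' *\<^sub>R sp a c'"
    using comb[OF 1(2) 2(2) 1(4) 2(4)] by blast
  have "v + w = N *\<^sub>R d - N' *\<^sub>R d'"
    unfolding N(3) N'(3) 1(5) 2(5) by simp
  then have "ext a (v + w) = N *\<^sub>R sp a d - N' *\<^sub>R sp a d'"
    using ext_eq[OF a N(1) N'(1) N(2) N'(2)] by (simp only:)
  also have "\<dots> = ext a v + ext a w"
    unfolding N(4) N'(4) 1(5) 2(5) ext_eq[OF a 1(1-4)] ext_eq[OF a 2(1-4)] by simp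
  finally show ?thesis .
qed

lemma ext_scaleR:
  assumes a: "a \<in> effects" and v: "v \<in> self_adjoint_ops"
  shows "ext a (r *\<^sub>R v) = r *\<^sub>R ext a v"
proof -
  obtain s t b c where 1: "0 \<le> s" "0 \<le> t" "b \<in> effects" "c \<in> effects" "v = s *\<^sub>R b - t *\<^sub>R c"
    using self_adjoint_effect_decomposition[OF v] by metis
  show ?thesis
  proof (cases "0 \<le> r")
    case True
    then show ?thesis
      using ext_eq[OF a _ _ 1(3,4), of "r * s" "r * t"] ext_eq[OF a 1(1-4)] 1
      by (simp add: scaleR_diff_right)
  next
    case False
    then have "0 \<le> - r * t" "0 \<le> - r * s"
      using 1(1,2) by (simp_all add: mult_nonpos_nonneg)
    from ext_eq[OF a this 1(4,3)] show ?thesis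
      using ext_eq[OF a 1(1-4)] 1(5) by (simp add: scaleR_diff_right)
  qed
qed

lemma ext_diff:
  assumes "a \<in> effects" "v \<in> self_adjoint_ops" "w \<in> self_adjoint_ops"
  shows "ext a (v - w) = ext a v - ext a w"
  using ext_add[OF assms(1,2) self_adjoint_scaleR[OF assms(3)], of "-1"] ext_scaleR[OF assms(1,3), of "-1"]
  by simp

section \<open>Monotonicity, and products with projections\<close>

lemma sp_mono:
  assumes "a \<in> effects" "b \<in> effects" "c \<in> effects" "b \<preceq> c"
  shows "sp a b \<preceq> sp a c"
proof -
  have "0 \<preceq> ext a (c - b)"
    using assms by (intro ext_pos) (auto simp: op_le_iff blinfun.diff_left inner_diff_right)
  then show ?thesis
    using ext_diff[OF assms(1) effectD(1)[OF assms(3)] effectD(1)[OF assms(2)]]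
      ext_effect[OF assms(1,2)] ext_effect[OF assms(1,3)]
    by (auto simp: op_le_iff blinfun.diff_left inner_diff_right)
qed

lemma sp_eq_0_mono:
  assumes "a \<in> effects" "b \<in> effects" "c \<in> effects" "b \<preceq> c" "sp a c = 0"
  shows "sp a b = 0"
proof (rule self_adjoint_eqI)
  show "inner x (sp a b x) = inner x (blinfun_apply 0 x)" for x
    using sp_mono[OF assms(1-4)] effectD(2)[OF sp_effect[OF assms(1,2)], of x] assms(5)
    by (auto simp: op_le_iff intro: antisym)
qed (use assms sp_effect in auto)

text \<open>As p commutes with itself, it commutes with q = 1 - p. The common value c of p \<circ> q
  and q \<circ> p is below p \<circ> 1 = p and below q \<circ> 1 = q, so it vanishes on the ranges
  of both q and p.\<close>

lemma sp_projection_compl: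
  assumes p: "p \<in> projections"
  shows "sp p (id_blinfun - p) = 0"
proof -
  let ?q = "id_blinfun - p" and ?c = "sp p (id_blinfun - p)"
  have pe: "p \<in> effects" and qe: "?q \<in> effects"
    using p by (auto intro: projection_effect effect_diff_id)
  have c: "?c \<in> effects" using pe qe by (rule sp_effect)
  have "?c \<preceq> sp p id_blinfun"
    using pe qe effectD(2)[OF pe]
    by (intro sp_mono) (auto simp: effect_id op_le_iff blinfun.diff_left inner_diff_right)
  then have cp: "?c \<preceq> p" by (simp add: sp_id_right pe)
  have "?c = sp ?q p"
    using sp_commute_compl[OF pe pe] by simp
  moreover have "sp ?q p \<preceq> sp ?q id_blinfun"
    using pe by (intro sp_mono qe pe effect_id) (simp add: effects_def)
  ultimately have cq: "?c \<preceq> ?q" by (simp add: sp_id_right qe)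
  have zero: "?c x = 0" if "inner x (?c x) \<le> 0" for x
    using positive_inner_eq_0[OF effectD(1,2)[OF c] antisym[OF that effectD(2)[OF c]]] .
  show ?thesis
  proof (rule blinfun_eqI)
    fix x
    have "?c (p x) = 0"
    proof (rule zero)
      have "inner (p x) (?q (p x)) = 0"
        by (simp add: blinfun.diff_left projectionD(2)[OF p])
      then show "inner (p x) (?c (p x)) \<le> 0"
        using cq unfolding op_le_iff by metis
    qed
    moreover have "?c (x - p x) = 0"
    proof (rule zero)
      have "inner (x - p x) (p (x - p x)) = 0"
        using projectionD(2)[OF p] by (simp add: blinfun.diff_right)
      then show "inner (x - p x) (?c (x - p x)) \<le> 0"
        using cp unfolding op_le_iff by metis
    qed
    ultimately show "?c x = blinfun_apply 0 x"
      by (simp add: blinfun.diff_right)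
  qed
qed

lemma sp_orthogonal_projection:
  assumes p: "p \<in> projections" and b: "b \<in> effects" "b \<preceq> id_blinfun - p"
  shows "sp p b = 0" "sp b p = 0"
proof -
  have pe: "p \<in> effects" using p by (rule projection_effect)
  show "sp p b = 0"
    using sp_eq_0_mono[OF pe b(1) _ b(2) sp_projection_compl[OF p]] effect_diff_id[OF pe] .
  then show "sp b p = 0"
    using sp_zero_sym pe b(1) by blast
qed

text \<open>Both products of b with 1 - p are 0, so b commutes with 1 - p and hence with p. Then b
  \<circ> p = b \<circ> p + b \<circ> (1 - p) = b \<circ> 1 = b.\<close>

lemma sp_below_projection:
  assumes p: "p \<in> projections" and b: "b \<in> effects" "b \<preceq> p"
  shows "sp p b = b" "sp b p = b"
proof -
  let ?q = "id_blinfun - p"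
  have pe: "p \<in> effects" and qe: "?q \<in> effects"
    using p by (auto intro: projection_effect effect_diff_id)
  have 0: "sp ?q b = 0" "sp b ?q = 0"
    using sp_orthogonal_projection[OF projection_id_diff[OF p] b(1)] b(2) by simp_all
  then have comm: "sp b p = sp p b"
    using sp_commute_compl[OF b(1) qe] by simp
  have "sp b (p + ?q) = sp b p + sp b ?q"
    using pe qe b by (intro sp_add) (auto simp: op_le_iff)
  then show "sp b p = b"
    using 0 sp_id_right[OF b(1)] by simp
  then show "sp p b = b" using comm by simp
qed

lemma compress_effect:
  assumes p: "p \<in> projections" and b: "b \<in> effects"
  shows "p o\<^sub>L b o\<^sub>L p \<in> effects" "p o\<^sub>L b o\<^sub>L p \<preceq> p"
proof -
  note ps = projectionD[OF p]
  have eq: "inner x ((p o\<^sub>L b o\<^sub>L p) x) = inner (p x) (b (p x))" for x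
    by (simp add: self_adjointD(2)[OF ps(1)])
  have le: "inner x ((p o\<^sub>L b o\<^sub>L p) x) \<le> inner x (p x)" for x
    unfolding eq ps(3) power2_norm_eq_inner by (rule effectD(3)[OF b])
  then show "p o\<^sub>L b o\<^sub>L p \<preceq> p"
    by (simp add: op_le_iff)
  have "inner x ((p o\<^sub>L b o\<^sub>L p) x) \<le> inner x x" for x
    using le[of x] effectD(3)[OF projection_effect[OF p], of x] by linarith
  moreover have "p o\<^sub>L b o\<^sub>L p \<in> self_adjoint_ops"
    using ps b by auto
  ultimately show "p o\<^sub>L b o\<^sub>L p \<in> effects"
    by (simp add: effects_iff) (use effectD(2)[OF b] eq in simp)
qed

text \<open>In b = p b p + q b q + V the first two terms are settled by the preceding lemmas. For
  the off-diagonal V, the inequality 2 r s \<le> t r^2 + s^2 / t gives \<plusminus>V \<le> t p + q /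
  t for every t > 0. The positive map \<open>ext p\<close> fixes p and kills q, so \<plusminus>W
  \<le> t p; letting t tend to 0 gives W = 0.\<close>

lemma sp_projection:
  assumes p: "p \<in> projections" and b: "b \<in> effects"
  shows "sp p b = p o\<^sub>L b o\<^sub>L p"
proof -
  define q where "q = id_blinfun - p"
  define V where "V = b - (p o\<^sub>L b o\<^sub>L p) - (q o\<^sub>L b o\<^sub>L q)"
  note ps = projectionD[OF p]
  have q: "q \<in> projections" "q \<in> effects" "q \<in> self_adjoint_ops"
    using p projection_id_diff projection_effect projectionD(1) by (auto simp: q_def)
  have pe: "p \<in> effects" using p by (rule projection_effect)
  have qx: "q x = x - p x" for x by (simp add: q_def blinfun.diff_left)
  note pbp = compress_effect[OF p b] and qbq = compress_effect[OF q(1) b]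
  have V: "V \<in> self_adjoint_ops"
    unfolding V_def using pbp qbq b by auto
  have Vx: "inner x (V x) = 2 * inner (p x) (b (q x))" for x
    using self_adjointD(2)[OF effectD(1)[OF b], of "p x" x]
      self_adjointD(2)[OF effectD(1)[OF b], of "p x" "p x"]
    by (simp add: V_def qx blinfun.bilinear_simps inner_simps self_adjointD(2)[OF ps(1), symmetric])
      (simp add: inner_commute)
  have Vb: "\<bar>inner x (V x)\<bar> \<le> t * (norm (p x))\<^sup>2 + (1/t) * (norm (q x))\<^sup>2" if t: "t > 0" for x t
  proof -
    have "norm (b (q x)) \<le> norm b * norm (q x)" by (rule norm_blinfun)
    also have "\<dots> \<le> norm (q x)"
      using effect_norm_le[OF b] mult_right_mono[of "norm b" 1 "norm (q x)"] by simp
    finally have "\<bar>inner (p x) (b (q x))\<bar> \<le> norm (p x) * norm (q x)"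
      using Cauchy_Schwarz_ineq2[of "p x" "b (q x)"] mult_left_mono[of _ _ "norm (p x)"]
      by (meson norm_ge_zero order_trans)
    moreover have "0 \<le> (t * norm (p x) - norm (q x))\<^sup>2 / t"
      using t by simp
    then have "2 * (norm (p x) * norm (q x)) \<le> t * (norm (p x))\<^sup>2 + (1/t) * (norm (q x))\<^sup>2"
      using t by (simp add: power2_eq_square field_simps)
    ultimately show ?thesis by (simp add: Vx abs_mult)
  qed
  define W where "W = ext p V"
  have W: "W \<in> self_adjoint_ops" unfolding W_def using pe V by (rule ext_self_adjoint)
  have spp: "ext p p = p" "ext p q = 0"
    using sp_below_projection[OF p pe] sp_projection_compl[OF p] pe q
    by (auto simp: ext_effect op_le_iff q_def)
  have Wb: "\<bar>inner y (W y)\<bar> \<le> t * inner y (p y)" if t: "t > 0" for t y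
  proof -
    have *: "0 \<le> t * inner y (p y) + r * inner y (W y)" if r: "r = 1 \<or> r = -1" for r
    proof -
      let ?Z = "t *\<^sub>R p + (1/t) *\<^sub>R q + r *\<^sub>R V"
      have "0 \<preceq> ?Z"
        unfolding op_le_iff
      proof
        fix x
        show "inner x (blinfun_apply 0 x) \<le> inner x (?Z x)"
          using Vb[OF t, of x] r
          by (auto simp: blinfun.bilinear_simps inner_add_right ps(3) projectionD(3)[OF q(1)])
      qed
      then have "0 \<preceq> ext p ?Z"
        using pe ps(1) q V by (intro ext_pos) auto
      moreover have "ext p ?Z = t *\<^sub>R p + r *\<^sub>R W"
        using pe ps(1) q(3) V
        by (simp add: ext_add ext_scaleR self_adjoint_intros spp W_def)
      ultimately show ?thesis
        by (simp add: op_le_iff blinfun.bilinear_simps inner_add_right)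
    qed
    from *[of 1] *[of "-1"] show ?thesis by simp
  qed
  have "W = 0"
  proof (rule self_adjoint_eqI[OF W self_adjoint_zero])
    fix y
    have "\<bar>inner y (W y)\<bar> \<le> 0"
    proof (rule LIMSEQ_le_const)
      show "(\<lambda>n. (1 / real (Suc n)) * inner y (p y)) \<longlonglongrightarrow> 0"
        using LIMSEQ_Suc[OF lim_const_over_n[of "inner y (p y)"]] by simp
      show "\<exists>N. \<forall>n\<ge>N. \<bar>inner y (W y)\<bar> \<le> (1 / real (Suc n)) * inner y (p y)"
        by (intro exI allI impI Wb) simp
    qed
    then show "inner y (W y) = inner y (blinfun_apply 0 y)" by simp
  qed
  moreover have "b = V + (p o\<^sub>L b o\<^sub>L p) + (q o\<^sub>L b o\<^sub>L q)" by (simp add: V_def)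
  then have "ext p b = W + ext p (p o\<^sub>L b o\<^sub>L p) + ext p (q o\<^sub>L b o\<^sub>L q)"
    using pe V pbp(1) qbq(1) by (metis W_def effectD(1) ext_add self_adjoint_add)
  moreover have "sp p (p o\<^sub>L b o\<^sub>L p) = p o\<^sub>L b o\<^sub>L p"
    by (rule sp_below_projection[OF p pbp])
  moreover have "sp p (q o\<^sub>L b o\<^sub>L q) = 0"
    using sp_orthogonal_projection(1)[OF p] qbq by (simp add: q_def)
  ultimately show ?thesis
    using pe b pbp qbq by (simp add: ext_effect)
qed

text \<open>Operator commutation gives a = p a p + q a q. Sequentially, p commutes with the part
  below p and with the part below q, hence with their sum by axiom (5); the value is then known from
  \<open>sp_projection\<close>.\<close>

lemma sp_commuting_projection:
  assumes p: "p \<in> projections" and a: "a \<in> effects" and comm: "p o\<^sub>L a = a o\<^sub>L p"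
  shows "sp p a = p o\<^sub>L a" "sp a p = p o\<^sub>L a" "p o\<^sub>L a \<in> effects"
proof -
  define q where "q = id_blinfun - p"
  have q: "q \<in> projections"
    using p projection_id_diff by (auto simp: q_def)
  have pe: "p \<in> effects" using p by (rule projection_effect)
  have cx: "p (a x) = a (p x)" for x using comm by (simp add: commute_iff)
  have eq: "p o\<^sub>L a o\<^sub>L p = p o\<^sub>L a"
    by (rule blinfun_eqI) (simp add: cx projectionD(2)[OF p])
  have sum: "a = (p o\<^sub>L a o\<^sub>L p) + (q o\<^sub>L a o\<^sub>L q)"
    by (rule blinfun_eqI) (simp add: q_def cx projectionD(2)[OF p] blinfun.bilinear_simps)
  note pap = compress_effect[OF p a] and qaq = compress_effect[OF q a]
  show "p o\<^sub>L a \<in> effects" using pap(1) by (simp add: eq)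
  show spa: "sp p a = p o\<^sub>L a" using sp_projection[OF p a] by (simp add: eq)
  have "sp p ((p o\<^sub>L a o\<^sub>L p) + (q o\<^sub>L a o\<^sub>L q)) = sp ((p o\<^sub>L a o\<^sub>L p) + (q o\<^sub>L a o\<^sub>L q)) p"
  proof (rule sp_commute_add)
    show "sp p (p o\<^sub>L a o\<^sub>L p) = sp (p o\<^sub>L a o\<^sub>L p) p"
      using sp_below_projection[OF p pap] by simp
    show "sp p (q o\<^sub>L a o\<^sub>L q) = sp (q o\<^sub>L a o\<^sub>L q) p"
      using sp_orthogonal_projection[OF p qaq(1)] qaq(2) by (simp add: q_def)
    show "(p o\<^sub>L a o\<^sub>L p) + (q o\<^sub>L a o\<^sub>L q) \<preceq> id_blinfun"
      using a by (simp add: sum[symmetric] effects_def)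
  qed (fact pap(1) qaq(1) pe)+
  then show "sp a p = p o\<^sub>L a"
    using spa by (simp add: sum[symmetric])
qed

section \<open>Compression by projections that commute with the first factor\<close>

lemma sp_compress:
  assumes p: "p \<in> projections" and a: "a \<in> effects" and comm: "p o\<^sub>L a = a o\<^sub>L p" and b: "b \<in> effects"
  shows "p o\<^sub>L sp a b o\<^sub>L p = sp (p o\<^sub>L a) b" "sp a (p o\<^sub>L b o\<^sub>L p) = sp (p o\<^sub>L a) b"
proof -
  have pe: "p \<in> effects" using p by (rule projection_effect)
  note pa = sp_commuting_projection[OF p a comm]
  show "p o\<^sub>L sp a b o\<^sub>L p = sp (p o\<^sub>L a) b"
    using sp_assoc[OF pe a b] pa sp_projection[OF p sp_effect[OF a b]] by simp
  show "sp a (p o\<^sub>L b o\<^sub>L p) = sp (p o\<^sub>L a) b"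
    using sp_assoc[OF a pe b] pa sp_projection[OF p b] by simp
qed

lemma ext_compress:
  assumes p: "p \<in> projections" and a: "a \<in> effects" and comm: "p o\<^sub>L a = a o\<^sub>L p"
    and v: "v \<in> self_adjoint_ops"
  shows "p o\<^sub>L ext a v o\<^sub>L p = ext a (p o\<^sub>L v o\<^sub>L p)"
proof -
  obtain s t b c where 1: "0 \<le> s" "0 \<le> t" "b \<in> effects" "c \<in> effects" "v = s *\<^sub>R b - t *\<^sub>R c"
    using self_adjoint_effect_decomposition[OF v] by metis
  have "p o\<^sub>L v o\<^sub>L p = s *\<^sub>R (p o\<^sub>L b o\<^sub>L p) - t *\<^sub>R (p o\<^sub>L c o\<^sub>L p)"
    by (simp add: 1 blinfun_compose_linear)
  moreover have "p o\<^sub>L ext a v o\<^sub>L p = s *\<^sub>R (p o\<^sub>L sp a b o\<^sub>L p) - t *\<^sub>R (p o\<^sub>L sp a c o\<^sub>L p)"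
    using ext_eq[OF a 1(1-4)] by (simp add: 1(5) blinfun_compose_linear)
  ultimately show ?thesis
    using ext_eq[OF a 1(1,2)] compress_effect[OF p] sp_compress[OF p a comm] 1(3,4) by simp
qed

end

locale invariant_seq_product = seq_product +
  assumes inv: "invariant_product sp"
begin

lemma ext_symmetry:
  assumes V: "involutive_symmetry V" and a: "a \<in> effects" and v: "v \<in> self_adjoint_ops"
  shows "V o\<^sub>L ext a v o\<^sub>L V = ext (V o\<^sub>L a o\<^sub>L V) (V o\<^sub>L v o\<^sub>L V)"
proof -
  obtain s t b c where 1: "0 \<le> s" "0 \<le> t" "b \<in> effects" "c \<in> effects" "v = s *\<^sub>R b - t *\<^sub>R c"
    using self_adjoint_effect_decomposition[OF v] by metis
  have sp: "V o\<^sub>L sp a b o\<^sub>L V = sp (V o\<^sub>L a o\<^sub>L V) (V o\<^sub>L b o\<^sub>L V)" if "b \<in> effects" for b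
    using inv involutive_symmetry_unital_order_iso[OF V] a that
    unfolding invariant_product_def by blast
  have "V o\<^sub>L v o\<^sub>L V = s *\<^sub>R (V o\<^sub>L b o\<^sub>L V) - t *\<^sub>R (V o\<^sub>L c o\<^sub>L V)"
    by (simp add: 1 blinfun_compose_linear)
  moreover have "V o\<^sub>L ext a v o\<^sub>L V = s *\<^sub>R (V o\<^sub>L sp a b o\<^sub>L V) - t *\<^sub>R (V o\<^sub>L sp a c o\<^sub>L V)"
    using ext_eq[OF a 1(1-4)] by (simp add: 1(5) blinfun_compose_linear)
  ultimately show ?thesis
    using ext_eq[OF involutive_symmetry_effect[OF V a] 1(1,2)] involutive_symmetry_effect[OF V]
      sp 1(3,4) by simp
qed

end

section \<open>Effects on a two-dimensional subspace\<close>

text \<open>The two conditions in \<open>orth\<close> are the real and the imaginary part of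
  \<open>cinner e f = 0\<close>.\<close>

locale orthonormal_pair =
  fixes e f :: "'a::chilbert_space"
  assumes norm_e: "norm e = 1" and norm_f: "norm f = 1"
    and orth: "inner e f = 0" "inner (imult e) f = 0"
begin

definition diag :: "real \<Rightarrow> real \<Rightarrow> 'a \<Rightarrow>\<^sub>L 'a" where
  "diag l m = l *\<^sub>R ket_bra e e + m *\<^sub>R ket_bra f f"

definition flip :: "'a \<Rightarrow>\<^sub>L 'a" where
  "flip = ket_bra e f + ket_bra f e"

lemma diag_apply: "diag l m x = l *\<^sub>R ket_bra e e x + m *\<^sub>R ket_bra f f x"
  and flip_apply: "flip x = ket_bra e f x + ket_bra f e x"
  by (simp_all add: diag_def flip_def blinfun.add_left blinfun.scaleR_left)

lemma inner_pair: "inner e e = 1" "inner f f = 1" "inner f e = 0" "inner (imult f) e = 0"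
  using norm_e norm_f orth inner_imult_right[of e f]
  by (simp_all add: norm_eq_1 inner_commute)

lemma ket_bra_pair [simp]:
  "ket_bra e e e = e" "ket_bra e e f = 0" "ket_bra e f e = 0" "ket_bra e f f = e"
  "ket_bra f e e = f" "ket_bra f e f = 0" "ket_bra f f e = 0" "ket_bra f f f = f"
  by (simp_all add: ket_bra_apply orth inner_pair)

lemmas pair_simps = diag_apply flip_apply ket_bra_ket_bra ket_bra_linear_left
  blinfun.bilinear_simps

lemma diag_self_adjoint: "diag l m \<in> self_adjoint_ops"
  by (auto simp: diag_def intro: ket_bra_self_adjoint)

lemma flip_self_adjoint: "flip \<in> self_adjoint_ops"
  unfolding flip_def by (rule ket_bra_sym_self_adjoint)

lemma diag_compose: "diag l m o\<^sub>L diag l' m' = diag (l * l') (m * m')"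
  by (rule blinfun_eqI) (simp add: pair_simps mult.commute)

lemma diag_projections: "diag 1 1 \<in> projections" "diag 1 0 \<in> projections" "diag 0 1 \<in> projections"
  by (auto simp: projections_def diag_self_adjoint diag_compose)

lemma diag_effect:
  assumes "0 \<le> l" "l \<le> 1" "0 \<le> m" "m \<le> 1"
  shows "diag l m \<in> effects"
  unfolding effects_iff
proof (intro conjI allI)
  fix x
  let ?p = "inner x (ket_bra e e x)" and ?q = "inner x (ket_bra f f x)"
  have nonneg: "0 \<le> ?p" "0 \<le> ?q"
    using projectionD(3)[OF ket_bra_projection[OF norm_e]] projectionD(3)[OF ket_bra_projection[OF norm_f]]
    by simp_all
  have sum: "?p + ?q \<le> inner x x"
    using effectD(3)[OF projection_effect[OF diag_projections(1)], of x]
    by (simp add: diag_apply inner_add_right)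
  have eq: "inner x (diag l m x) = l * ?p + m * ?q"
    by (simp add: diag_apply inner_add_right)
  show "0 \<le> inner x (diag l m x)"
    unfolding eq using nonneg assms by simp
  have "l * ?p \<le> ?p" "m * ?q \<le> ?q"
    using nonneg assms by (simp_all add: mult_left_le_one_le)
  then show "inner x (diag l m x) \<le> inner x x"
    unfolding eq using sum by linarith
qed (rule diag_self_adjoint)

lemma flip_compose: "flip o\<^sub>L flip = diag 1 1" "diag 1 1 o\<^sub>L flip = flip" "flip o\<^sub>L diag 1 1 = flip"
  by (rule blinfun_eqI, simp add: pair_simps)+

text \<open>The projection onto the line of (e + f) / \<surd>2. It writes \<open>flip\<close> as
  \<open>2 *\<^sub>R mid - diag 1 1\<close>, a difference of multiples of effects that
  \<open>ext_eq\<close> can evaluate.\<close>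

definition mid :: "'a \<Rightarrow>\<^sub>L 'a" where
  "mid = (1/2) *\<^sub>R (diag 1 1 + flip)"

lemma mid_projection: "mid \<in> projections"
proof -
  have "mid o\<^sub>L mid = mid"
    by (rule blinfun_eqI) (simp add: mid_def pair_simps scaleR_2[symmetric] add_ac)
  moreover have "mid \<in> self_adjoint_ops"
    unfolding mid_def by (intro self_adjoint_intros diag_self_adjoint flip_self_adjoint)
  ultimately show ?thesis by (simp add: projections_def)
qed

lemma flip_mid: "flip = 2 *\<^sub>R mid - diag 1 1"
  by (simp add: mid_def)

lemma diag_mid_commute: "mid o\<^sub>L diag t t = diag t t o\<^sub>L mid" "mid o\<^sub>L diag t t = t *\<^sub>R mid"
  by (rule blinfun_eqI, simp add: mid_def pair_simps algebra_simps)+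

lemma swap_symmetry: "involutive_symmetry (id_blinfun - diag 1 1 + flip)"
proof -
  let ?S = "id_blinfun - diag 1 1 + flip"
  have S: "?S \<in> self_adjoint_ops"
    by (intro self_adjoint_intros diag_self_adjoint flip_self_adjoint)
  have SS: "?S (?S x) = x" for x
    by (simp add: pair_simps)
  have "inner (?S x) (?S y) = inner x y" for x y
    using self_adjointD(2)[OF S, of x "?S y"] by (simp only: SS)
  then show ?thesis
    using SS self_adjointD(1)[OF S] unfolding involutive_symmetry_def by blast
qed

lemma swap_compose:
  defines "S \<equiv> id_blinfun - diag 1 1 + flip"
  shows "S o\<^sub>L diag l m o\<^sub>L S = diag m l" "S o\<^sub>L flip o\<^sub>L S = flip"
  by (rule blinfun_eqI, simp add: S_def pair_simps)+

text \<open>For vectors u, w fixed by C, moving C across the inner product turns \<langle>i u, W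
  w\<rangle> into its negative. All matrix entries of W at e and f are therefore real, and a real
  symmetric 2 by 2 matrix is a diagonal plus a multiple of \<open>flip\<close>.\<close>

lemma compress_real:
  assumes W: "W \<in> self_adjoint_ops"
    and C: "involutive_symmetry C" "\<And>x. C (imult x) = - imult (C x)" "C e = e" "C f = f"
    and CW: "C o\<^sub>L W o\<^sub>L C = W"
  shows "diag 1 1 o\<^sub>L W o\<^sub>L diag 1 1 = diag (inner e (W e)) (inner f (W f)) + inner e (W f) *\<^sub>R flip"
proof (rule blinfun_eqI)
  fix x
  have imag: "inner (imult u) (W w) = 0" if "C u = u" "C w = w" for u w
  proof -
    have "inner (imult u) (W w) = inner (imult u) (C (W (C w)))"
      using CW by (metis blinfun_apply_blinfun_compose)
    also have "\<dots> = inner (C (imult u)) (W w)"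
      by (simp add: involutive_symmetryD(2)[OF C(1)] that(2))
    also have "\<dots> = - inner (imult u) (W w)"
      by (simp add: C(2) that(1))
    finally show ?thesis by simp
  qed
  have "inner f (W e) = inner e (W f)"
    using self_adjointD(2)[OF W, of e f] by (simp add: inner_commute)
  then have We: "diag 1 1 (W e) = inner e (W e) *\<^sub>R e + inner e (W f) *\<^sub>R f"
    and Wf: "diag 1 1 (W f) = inner e (W f) *\<^sub>R e + inner f (W f) *\<^sub>R f"
    using imag C(3,4) by (simp_all add: diag_apply ket_bra_apply)
  have "(diag 1 1 o\<^sub>L W o\<^sub>L diag 1 1) x = ket_bra (diag 1 1 (W e)) e x + ket_bra (diag 1 1 (W f)) f x"
    using self_adjoint_ket_bra(1)[OF W] self_adjoint_ket_bra(1)[OF diag_self_adjoint[of 1 1]]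
    by (simp add: diag_apply[of 1 1 x] blinfun.add_right)
  then show "(diag 1 1 o\<^sub>L W o\<^sub>L diag 1 1) x
      = (diag (inner e (W e)) (inner f (W f)) + inner e (W f) *\<^sub>R flip) x"
    unfolding We Wf by (simp add: pair_simps algebra_simps)
qed

lemma conjugation_compose:
  assumes C: "involutive_symmetry C" "\<And>x. C (imult x) = - imult (C x)" "C e = e" "C f = f"
  shows "C o\<^sub>L diag l m o\<^sub>L C = diag l m" "C o\<^sub>L flip o\<^sub>L C = flip"
proof -
  have kb: "C (ket_bra u v (C x)) = ket_bra u v x" if "C u = u" "C v = v" for u v x
  proof -
    have "C (imult v) = - imult v" "C (imult u) = - imult u"
      using C(2)[of v] C(2)[of u] that by simp_all
    moreover from this have "inner v (C x) = inner v x" "inner (imult v) (C x) = - inner (imult v) x"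
      using involutive_symmetryD(2)[OF C(1), of v x] involutive_symmetryD(2)[OF C(1), of "imult v" x] that
      by simp_all
    ultimately show ?thesis
      using that by (simp add: ket_bra_apply blinfun.bilinear_simps)
  qed
  show "C o\<^sub>L diag l m o\<^sub>L C = diag l m" "C o\<^sub>L flip o\<^sub>L C = flip"
    by (rule blinfun_eqI, simp add: diag_apply flip_apply blinfun.add_right blinfun.scaleR_right kb C(3,4))+
qed

end

section \<open>The factor by which a diagonal effect acts on off-diagonal entries\<close>

locale two_level = invariant_seq_product sp + orthonormal_pair e f
  for sp :: "('a::chilbert_space \<Rightarrow>\<^sub>L 'a) \<Rightarrow> ('a \<Rightarrow>\<^sub>L 'a) \<Rightarrow> ('a \<Rightarrow>\<^sub>L 'a)" and e f :: 'a
begin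

lemma ext_diag:
  assumes "0 \<le> l" "l \<le> 1" "0 \<le> m" "m \<le> 1"
  shows "ext (diag l m) (diag l' m') = diag (l * l') (m * m')"
proof -
  note D = diag_effect[OF assms]
  have split: "diag x y = x *\<^sub>R diag 1 0 + y *\<^sub>R diag 0 1" for x y
    by (simp add: diag_def)
  have "sp (diag l m) (diag 1 0) = diag l 0" "sp (diag l m) (diag 0 1) = diag 0 m"
    using sp_commuting_projection(2)[OF diag_projections(2) D]
      sp_commuting_projection(2)[OF diag_projections(3) D] by (simp_all add: diag_compose)
  then have "ext (diag l m) (diag l' m') = l' *\<^sub>R diag l 0 + m' *\<^sub>R diag 0 m"
    using D diag_projections(2,3)
    by (subst split) (simp add: ext_add ext_scaleR self_adjoint_scaleR diag_self_adjoint ext_effect projection_effect)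
  then show ?thesis
    by (simp add: diag_def mult.commute)
qed

definition coeff :: "real \<Rightarrow> real \<Rightarrow> real" where
  "coeff l m = inner e (ext (diag l m) flip f)"

text \<open>Compression by \<open>diag 1 1\<close> confines the image to the block of e and f, and a
  conjugation fixing e and f makes it real there. Compressing \<open>flip\<close> by
  \<open>diag 1 0\<close> or \<open>diag 0 1\<close> gives 0, so the image has no diagonal entries
  either.\<close>

lemma ext_flip:
  assumes "0 \<le> l" "l \<le> 1" "0 \<le> m" "m \<le> 1"
  shows "ext (diag l m) flip = coeff l m *\<^sub>R flip"
proof -
  note D = diag_effect[OF assms]
  obtain C where C: "involutive_symmetry C" "\<And>x. C (imult x) = - imult (C x)" "C e = e" "C f = f"
    using conjugation_exists[OF orth(2)] by metis
  let ?V = "ext (diag l m) flip"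
  have V: "?V \<in> self_adjoint_ops"
    using D flip_self_adjoint by (rule ext_self_adjoint)
  have "C o\<^sub>L ?V o\<^sub>L C = ?V"
    using ext_symmetry[OF C(1) D flip_self_adjoint] by (simp add: conjugation_compose[OF C])
  note compr = compress_real[OF V C this]
  have "diag 1 1 o\<^sub>L ?V o\<^sub>L diag 1 1 = ?V"
    using ext_compress[OF diag_projections(1) D _ flip_self_adjoint]
    by (simp add: diag_compose flip_compose)
  moreover have "inner e (?V e) = 0"
  proof -
    \<comment> \<open>The zero operator appears as a multiple of \<open>flip\<close>, whose image
      under \<open>ext\<close> is given by \<open>ext_scaleR\<close>.\<close>
    have "diag 1 0 o\<^sub>L flip o\<^sub>L diag 1 0 = 0 *\<^sub>R flip"
      by (rule blinfun_eqI) (simp add: pair_simps)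
    then have "diag 1 0 o\<^sub>L ?V o\<^sub>L diag 1 0 = 0"
      using ext_compress[OF diag_projections(2) D _ flip_self_adjoint]
        ext_scaleR[OF D flip_self_adjoint, of 0] by (simp add: diag_compose)
    then have "diag 1 0 (?V (diag 1 0 e)) = 0"
      by (metis blinfun_apply_blinfun_compose zero_blinfun.rep_eq)
    then have "inner (diag 1 0 e) (?V e) = 0"
      using self_adjointD(2)[OF diag_self_adjoint, of 1 0 e "?V e"] by (simp add: diag_apply)
    then show ?thesis by (simp add: diag_apply)
  qed
  moreover have "inner f (?V f) = 0"
  proof -
    have "diag 0 1 o\<^sub>L flip o\<^sub>L diag 0 1 = 0 *\<^sub>R flip"
      by (rule blinfun_eqI) (simp add: pair_simps)
    then have "diag 0 1 o\<^sub>L ?V o\<^sub>L diag 0 1 = 0"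
      using ext_compress[OF diag_projections(3) D _ flip_self_adjoint]
        ext_scaleR[OF D flip_self_adjoint, of 0] by (simp add: diag_compose)
    then have "diag 0 1 (?V (diag 0 1 f)) = 0"
      by (metis blinfun_apply_blinfun_compose zero_blinfun.rep_eq)
    then have "inner (diag 0 1 f) (?V f) = 0"
      using self_adjointD(2)[OF diag_self_adjoint, of 0 1 f "?V f"] by (simp add: diag_apply)
    then show ?thesis by (simp add: diag_apply)
  qed
  ultimately show ?thesis
    using compr by (simp add: coeff_def diag_def)
qed

lemma coeff_eqI:
  assumes "ext (diag l m) flip = k *\<^sub>R flip"
  shows "coeff l m = k"
  by (simp add: coeff_def assms blinfun.scaleR_left flip_apply inner_pair)

text \<open>Both orders of the product of the two diagonal effects give the same diagonal effect, so
  they commute sequentially and axiom (4) provides associativity. It transfers from effects to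
  \<open>flip\<close> through \<open>mid\<close>.\<close>

lemma coeff_mult:
  assumes 1: "0 \<le> l" "l \<le> 1" "0 \<le> m" "m \<le> 1" and 2: "0 \<le> l'" "l' \<le> 1" "0 \<le> m'" "m' \<le> 1"
  shows "coeff (l * l') (m * m') = coeff l m * coeff l' m'"
proof -
  note D1 = diag_effect[OF 1] and D2 = diag_effect[OF 2]
  have 3: "0 \<le> l * l'" "l * l' \<le> 1" "0 \<le> m * m'" "m * m' \<le> 1"
    using 1 2 by (auto intro: mult_le_one)
  note D3 = diag_effect[OF 3]
  note r = projection_effect[OF diag_projections(1)] and g = projection_effect[OF mid_projection]
  have sp12: "sp (diag l m) (diag l' m') = diag (l * l') (m * m')"
    "sp (diag l' m') (diag l m) = diag (l * l') (m * m')"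
    using ext_diag[OF 1, of l' m'] ext_diag[OF 2, of l m] ext_effect[OF D1 D2] ext_effect[OF D2 D1]
    by (simp_all add: mult.commute)
  have assoc: "sp (diag l m) (sp (diag l' m') b) = sp (diag (l * l') (m * m')) b" if "b \<in> effects" for b
    using sp_assoc[OF D1 D2 that] sp12 by simp
  have ext_flip_mid: "ext a flip = 2 *\<^sub>R sp a mid - sp a (diag 1 1)" if "a \<in> effects" for a
    using ext_eq[OF that _ _ g r, of 2 1] by (simp add: flip_mid)
  have "ext (diag l m) (ext (diag l' m') flip) = ext (diag (l * l') (m * m')) flip"
    using ext_eq[OF D1 _ _ sp_effect[OF D2 g] sp_effect[OF D2 r], of 2 1]
    by (simp add: ext_flip_mid[OF D2] ext_flip_mid[OF D3] assoc g r)
  then have "ext (diag (l * l') (m * m')) flip = (coeff l m * coeff l' m') *\<^sub>R flip"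
    by (simp add: ext_flip[OF 2] ext_flip[OF 1] ext_scaleR[OF D1 flip_self_adjoint] mult.commute)
  then show ?thesis by (rule coeff_eqI)
qed

lemma coeff_swap:
  assumes "0 \<le> l" "l \<le> 1" "0 \<le> m" "m \<le> 1"
  shows "coeff m l = coeff l m"
proof (rule coeff_eqI)
  show "ext (diag m l) flip = coeff l m *\<^sub>R flip"
    using ext_symmetry[OF swap_symmetry diag_effect[OF assms] flip_self_adjoint]
    unfolding ext_flip[OF assms] swap_compose blinfun_compose_linear(5,6) by simp
qed

text \<open>A scalar block commutes with the projection \<open>mid\<close>, so its product with
  \<open>mid\<close> is the operator product, which is t times \<open>mid\<close>.\<close>

lemma coeff_same:
  assumes "0 \<le> t" "t \<le> 1"
  shows "coeff t t = t"
proof (rule coeff_eqI)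
  note D = diag_effect[OF assms assms]
  have "sp (diag t t) mid = t *\<^sub>R mid"
    using sp_commuting_projection(2)[OF mid_projection D] diag_mid_commute by simp
  moreover have "sp (diag t t) (diag 1 1) = t *\<^sub>R diag 1 1"
    using ext_diag[OF assms assms, of 1 1] D projection_effect[OF diag_projections(1)]
    by (simp add: ext_effect) (simp add: diag_def scaleR_add_right)
  ultimately show "ext (diag t t) flip = t *\<^sub>R flip"
    using ext_eq[OF D _ _ projection_effect[OF mid_projection] projection_effect[OF diag_projections(1)], of 2 1]
    by (simp add: flip_mid scaleR_diff_right)
qed

lemma coeff_eq:
  assumes "0 \<le> l" "l \<le> 1" "0 \<le> m" "m \<le> 1"
  shows "coeff l m = sqrt l * sqrt m"
proof -
  have "coeff l m * coeff m l = l * m"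
    using coeff_mult[OF assms assms(3,4,1,2)] coeff_same[of "l * m"] assms
    by (simp add: mult.commute mult_le_one)
  then have "(coeff l m)\<^sup>2 = l * m"
    using coeff_swap[OF assms] by (simp add: power2_eq_square)
  moreover have "coeff l m = (coeff (sqrt l) (sqrt m))\<^sup>2"
    using coeff_mult[of "sqrt l" "sqrt m" "sqrt l" "sqrt m"] assms by (simp add: power2_eq_square)
  then have "0 \<le> coeff l m" by simp
  ultimately have "coeff l m = sqrt (l * m)"
    by (simp add: real_sqrt_unique)
  then show ?thesis by (simp add: real_sqrt_mult)
qed

text \<open>The block of b may have complex entries, out of reach of \<open>compress_real\<close>.
  The symmetrisation v = b + C b C is invariant under C, and passing from b to v doubles the real
  entry between e and f on both sides of the claim.\<close>

lemma inner_sp_diag: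
  assumes lm: "0 \<le> l" "l \<le> 1" "0 \<le> m" "m \<le> 1" and b: "b \<in> effects"
  shows "inner e (sp (diag l m) b f) = sqrt l * sqrt m * inner e (b f)"
proof -
  let ?A = "diag l m"
  note D = diag_effect[OF lm]
  obtain C where C: "involutive_symmetry C" "\<And>x. C (imult x) = - imult (C x)" "C e = e" "C f = f"
    using conjugation_exists[OF orth(2)] by metis
  let ?b = "C o\<^sub>L b o\<^sub>L C"
  have b': "?b \<in> effects" using C(1) b by (rule involutive_symmetry_effect)
  define v where "v = b + ?b"
  have v: "v \<in> self_adjoint_ops" using b b' by (auto simp: v_def)
  have CC: "C (C x) = x" for x by (rule involutive_symmetryD(1)[OF C(1)])
  have Cv: "C o\<^sub>L v o\<^sub>L C = v"
    by (rule blinfun_eqI) (simp add: v_def blinfun.bilinear_simps CC)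
  have Cfix: "inner e ((C o\<^sub>L T o\<^sub>L C) f) = inner e (T f)" for T :: "'a \<Rightarrow>\<^sub>L 'a"
    using involutive_symmetryD(2)[OF C(1), of e "T f"] by (simp add: C(3,4))
  have "C o\<^sub>L sp ?A b o\<^sub>L C = sp ?A ?b"
    using ext_symmetry[OF C(1) D effectD(1)[OF b]]
    by (simp add: conjugation_compose[OF C] ext_effect D b b')
  then have "inner e (ext ?A v f) = 2 * inner e (sp ?A b f)"
    using Cfix[of "sp ?A b"] D b b'
    by (simp add: v_def ext_add effectD(1) ext_effect blinfun.add_left inner_add_right)
  moreover have "inner e (v f) = 2 * inner e (b f)"
    using Cfix[of b] by (simp add: v_def blinfun.add_left inner_add_right)
  moreover have "inner e (ext ?A v f) = sqrt l * sqrt m * inner e (v f)"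
  proof -
    let ?B = "diag (inner e (v e)) (inner f (v f))" and ?x = "inner e (v f)"
    have "inner e (ext ?A v f) = inner (diag 1 1 e) (ext ?A v (diag 1 1 f))"
      by (simp add: diag_apply)
    also have "\<dots> = inner e ((diag 1 1 o\<^sub>L ext ?A v o\<^sub>L diag 1 1) f)"
      using self_adjointD(2)[OF diag_self_adjoint] by simp
    also have "diag 1 1 o\<^sub>L ext ?A v o\<^sub>L diag 1 1 = ext ?A (?B + ?x *\<^sub>R flip)"
      using ext_compress[OF diag_projections(1) D _ v]
      by (simp add: diag_compose compress_real[OF v C Cv])
    also have "\<dots> = diag (l * inner e (v e)) (m * inner f (v f)) + (?x * coeff l m) *\<^sub>R flip"
      using D by (simp add: ext_add ext_scaleR diag_self_adjoint flip_self_adjoint self_adjoint_scaleR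
          ext_diag[OF lm] ext_flip[OF lm])
    also have "inner e (\<dots> f) = ?x * coeff l m"
      by (simp add: pair_simps inner_add_right orth inner_pair)
    finally show ?thesis by (simp add: coeff_eq[OF lm])
  qed
  ultimately show ?thesis by simp
qed

end

section \<open>Matrix elements between eigenvectors\<close>

lemma ket_bra_eigenvector_commute:
  assumes a: "a \<in> self_adjoint_ops" and x: "a x = l *\<^sub>R x"
  shows "ket_bra x x o\<^sub>L a = a o\<^sub>L ket_bra x x" "ket_bra x x o\<^sub>L a = l *\<^sub>R ket_bra x x"
proof -
  have "a (ket_bra x x y) = l *\<^sub>R ket_bra x x y" "ket_bra x x (a y) = l *\<^sub>R ket_bra x x y" for y
    using self_adjointD(1)[OF a, of x] x
    by (simp_all add: self_adjoint_ket_bra[OF a] ket_bra_linear_left)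
      (simp add: ket_bra_apply imult_scaleR algebra_simps)
  then show "ket_bra x x o\<^sub>L a = a o\<^sub>L ket_bra x x" "ket_bra x x o\<^sub>L a = l *\<^sub>R ket_bra x x"
    by (auto intro!: blinfun_eqI simp: blinfun.scaleR_left)
qed

lemma eigenvalue_effect:
  assumes a: "a \<in> effects" and x: "a x = l *\<^sub>R x" "norm x = 1"
  shows "0 \<le> l" "l \<le> 1"
  using effectD(2,3)[OF a, of x] x by (simp_all add: norm_eq_1)

context invariant_seq_product
begin

lemma inner_sp_orthonormal:
  assumes a: "a \<in> effects" and b: "b \<in> effects"
    and x: "a x = l *\<^sub>R x" and y: "a y = m *\<^sub>R y" and pair: "orthonormal_pair x y"
  shows "inner x (sp a b y) = sqrt l * sqrt m * inner x (b y)"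
proof -
  interpret two_level sp x y
    using pair by (simp add: two_level_def invariant_seq_product_axioms)
  have lm: "0 \<le> l" "l \<le> 1" "0 \<le> m" "m \<le> 1"
    using eigenvalue_effect[OF a x norm_e] eigenvalue_effect[OF a y norm_f] by auto
  have sa: "a \<in> self_adjoint_ops" using a by auto
  note cx = ket_bra_eigenvector_commute[OF sa x] and cy = ket_bra_eigenvector_commute[OF sa y]
  have comm: "diag 1 1 o\<^sub>L a = a o\<^sub>L diag 1 1"
    using cx(1) cy(1) by (simp add: diag_def blinfun_compose_linear)
  have "diag 1 1 o\<^sub>L a = diag l m"
    using cx(2) cy(2) by (simp add: diag_def blinfun_compose_linear)
  then have sp: "diag 1 1 o\<^sub>L sp a b o\<^sub>L diag 1 1 = sp (diag l m) b"
    using sp_compress(1)[OF diag_projections(1) a comm b] by simp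
  have "inner x (sp a b y) = inner (diag 1 1 x) (sp a b (diag 1 1 y))"
    by (simp add: diag_apply)
  also have "\<dots> = inner x (sp (diag l m) b y)"
    using self_adjointD(2)[OF diag_self_adjoint] by (simp add: sp[symmetric])
  finally show ?thesis
    using inner_sp_diag[OF lm b] by simp
qed

text \<open>For the rank-one projection p onto the line of x, p b p is the real multiple \<langle>x,
  b x\<rangle> of p, and a \<circ> p = l p. Compression by p then reads off the diagonal
  entry.\<close>

lemma inner_sp_same:
  assumes a: "a \<in> effects" and b: "b \<in> effects" and x: "a x = l *\<^sub>R x" "norm x = 1"
  shows "inner x (sp a b x) = l * inner x (b x)"
proof -
  let ?p = "ket_bra x x"
  have p: "?p \<in> projections" using x(2) by (rule ket_bra_projection)
  have sa: "a \<in> self_adjoint_ops" "b \<in> self_adjoint_ops" using a b by auto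
  note cx = ket_bra_eigenvector_commute[OF sa(1) x(1)]
  have px: "?p x = x"
    using x(2) by (simp add: ket_bra_apply norm_eq_1)
  have imag: "inner (imult x) (b x) = 0"
    using self_adjointD[OF sa(2)] inner_imult_right[of x "b x"] by (metis inner_commute inner_imult_left
        inner_imult_self inner_imult_right minus_equation_iff neg_equal_zero)
  have "?p (b (?p z)) = inner x (b x) *\<^sub>R ?p z" for z
    by (simp add: self_adjoint_ket_bra(1)[OF sa(2)] ket_bra_ket_bra)
      (simp add: ket_bra_apply[of x x "b x"] imag ket_bra_linear_left)
  then have pbp: "?p o\<^sub>L b o\<^sub>L ?p = inner x (b x) *\<^sub>R ?p"
    by (auto intro!: blinfun_eqI simp: blinfun.scaleR_left)
  have pe: "?p \<in> effects" using p by (rule projection_effect)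
  have "sp a (?p o\<^sub>L b o\<^sub>L ?p) = ext a (inner x (b x) *\<^sub>R ?p)"
    using ext_effect[OF a compress_effect(1)[OF p b]] by (simp add: pbp)
  also have "\<dots> = (inner x (b x) * l) *\<^sub>R ?p"
    using ext_scaleR[OF a effectD(1)[OF pe]] ext_effect[OF a pe] sp_commuting_projection(2)[OF p a cx(1)] cx(2)
    by simp
  finally have "?p o\<^sub>L sp a b o\<^sub>L ?p = (inner x (b x) * l) *\<^sub>R ?p"
    using sp_compress[OF p a cx(1) b] by simp
  then have "?p (sp a b (?p x)) = (inner x (b x) * l) *\<^sub>R ?p x"
    by (metis blinfun_apply_blinfun_compose scaleR_blinfun.rep_eq)
  then have "inner x (?p (sp a b x)) = (inner x (b x) * l) * inner x x"
    by (simp add: px)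
  then show ?thesis
    using ket_bra_adjoint[of x x x "sp a b x"] x(2) by (simp add: px norm_eq_1 mult.commute)
qed

text \<open>Eigenvectors for the same eigenvalue need not be orthogonal. So y is split into its
  component along the complex line of x and a remainder z orthogonal to that line. Both are
  eigenvectors for m because the projection commutes with a, and a nonzero component along x forces
  l = m.\<close>

lemma inner_sp_eigenvectors:
  assumes a: "a \<in> effects" and b: "b \<in> effects"
    and x: "a x = l *\<^sub>R x" and y: "a y = m *\<^sub>R y" and nx: "norm x = 1"
  shows "inner x (sp a b y) = sqrt l * sqrt m * inner x (b y)"
proof -
  let ?p = "ket_bra x x"
  define z where "z = y - ?p y"
  have sa: "a \<in> self_adjoint_ops" using a by auto
  note cx = ket_bra_eigenvector_commute[OF sa x]
  have p: "?p \<in> projections" using nx by (rule ket_bra_projection)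
  have "?p (a y) = a (?p y)" "?p (a y) = l *\<^sub>R ?p y"
    using cx by (metis blinfun_apply_blinfun_compose, metis blinfun_apply_blinfun_compose scaleR_blinfun.rep_eq)
  moreover have "?p (a y) = m *\<^sub>R ?p y"
    by (simp add: y blinfun.scaleR_right)
  ultimately have apy: "a (?p y) = m *\<^sub>R ?p y" and lm: "l *\<^sub>R ?p y = m *\<^sub>R ?p y"
    by simp_all
  have z: "a z = m *\<^sub>R z"
    using apy y by (simp add: z_def blinfun.diff_right scaleR_diff_right)
  have "?p z = 0"
    by (simp add: z_def blinfun.diff_right projectionD(2)[OF p])
  then have "inner (?p x) z = 0" "inner (?p (imult x)) z = 0"
    by (simp_all add: ket_bra_adjoint)
  then have orth: "inner x z = 0" "inner (imult x) z = 0"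
    using nx by (auto simp: ket_bra_imult ket_bra_apply norm_eq_1)
  have Z: "inner x (sp a b z) = sqrt l * sqrt m * inner x (b z)"
  proof (cases "z = 0")
    case False
    let ?w = "(1 / norm z) *\<^sub>R z"
    have "orthonormal_pair x ?w"
      using orth nx False by unfold_locales auto
    moreover have "a ?w = m *\<^sub>R ?w"
      using z by (simp add: blinfun.scaleR_right)
    ultimately have "inner x (sp a b ?w) = sqrt l * sqrt m * inner x (b ?w)"
      using inner_sp_orthonormal[OF a b x] by blast
    then show ?thesis
      using False by (simp add: blinfun.scaleR_right)
  qed (simp add: blinfun.zero_right)
  have P: "inner x (sp a b (?p y)) = sqrt l * sqrt m * inner x (b (?p y))"
  proof (cases "?p y = 0")
    case False
    then have "l = m" using lm by simp
    then have "sqrt l * sqrt m = l"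
      using eigenvalue_effect[OF a x nx] by simp
    \<comment> \<open>The component of y along x is a complex multiple of x; self-adjointness
      removes the contribution of its imaginary part, leaving the diagonal entry.\<close>
    moreover have "inner x (T (imult x)) = 0" if "T \<in> self_adjoint_ops" for T
      using self_adjointD[OF that] by (metis inner_commute inner_imult_right equal_neg_zero)
    ultimately show ?thesis
      using inner_sp_same[OF a b x nx] sp_effect[OF a b] b
      by (simp add: ket_bra_apply blinfun.bilinear_simps inner_add_right effectD(1))
  qed (simp add: blinfun.zero_right)
  have "y = ?p y + z" by (simp add: z_def)
  then have "T y = T (?p y) + T z" for T :: "'a \<Rightarrow>\<^sub>L 'a"
    by (metis blinfun.add_right)
  from this[of "sp a b"] this[of b] show ?thesis
    using P Z by (simp add: inner_add_right distrib_left)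
qed

text \<open>The form \<langle>x, D y\<rangle> of the difference of the two sides vanishes on pairs
  of eigenvectors, and linearity in each variable carries this over the algebraic span, which is all
  of H.\<close>

lemma sp_spanning_eigenvectors:
  assumes a: "a \<in> effects" and b: "b \<in> effects" and span: "span {x. \<exists>l. a x = l *\<^sub>R x} = UNIV"
  shows "sp a b = op_sqrt a o\<^sub>L b o\<^sub>L op_sqrt a"
proof -
  let ?E = "{x. \<exists>l. a x = l *\<^sub>R x}" and ?s = "op_sqrt a"
  define D where "D = sp a b - (?s o\<^sub>L b o\<^sub>L ?s)"
  have eig: "inner x (D y) = 0" if x: "x \<in> ?E" and y: "y \<in> ?E" for x y
  proof (cases "x = 0")
    case False
    obtain l m where lm: "a x = l *\<^sub>R x" "a y = m *\<^sub>R y" using x y by blast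
    let ?w = "(1 / norm x) *\<^sub>R x"
    have "a ?w = l *\<^sub>R ?w" "norm ?w = 1"
      using lm(1) False by (simp_all add: blinfun.scaleR_right)
    from inner_sp_eigenvectors[OF a b this(1) lm(2) this(2)]
    have "inner x (sp a b y) = sqrt l * sqrt m * inner x (b y)"
      using False by simp
    moreover have "inner x (?s (b (?s y))) = sqrt l * sqrt m * inner x (b y)"
      unfolding self_adjointD(2)[OF op_sqrt(1)[OF a], symmetric]
        op_sqrt_eigenvector[OF a lm(1)] op_sqrt_eigenvector[OF a lm(2)]
      by (simp add: blinfun.scaleR_right)
    ultimately show ?thesis
      by (simp add: D_def blinfun.diff_left inner_diff_right)
  qed simp
  have eig': "inner x (D y) = 0" if "x \<in> ?E" for x y
  proof (rule linear_eq_0_on_span[where f = "\<lambda>y. inner x (D y)" and b = ?E])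
    show "linear (\<lambda>y. inner x (D y))"
      by (rule linearI) (simp_all add: blinfun.bilinear_simps inner_add_right)
  qed (use eig that span in auto)
  have "inner x (D y) = 0" for x y
  proof (rule linear_eq_0_on_span[where f = "\<lambda>x. inner x (D y)" and b = ?E])
    show "linear (\<lambda>x. inner x (D y))"
      by (rule linearI) (simp_all add: inner_add_left)
  qed (use eig' span in auto)
  then have "D y = 0" for y
    using inner_eq_zero_iff by blast
  then have "D = 0"
    by (intro blinfun_eqI) simp
  then show ?thesis by (simp add: D_def)
qed

end

theorem theorem5p9:
  fixes sp :: "('a::chilbert_space \<Rightarrow>\<^sub>L 'a) \<Rightarrow> ('a \<Rightarrow>\<^sub>L 'a) \<Rightarrow> ('a \<Rightarrow>\<^sub>L 'a)"
  assumes "sequential_product sp"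
    and "invariant_product sp"
    and "norm_continuous_fst sp"
  shows "\<forall>a\<in>effects. \<forall>b\<in>effects. sp a b = op_sqrt a o\<^sub>L b o\<^sub>L op_sqrt a"
proof (intro ballI)
  interpret invariant_seq_product sp
    using assms(1,2) by unfold_locales
  fix a b :: "'a \<Rightarrow>\<^sub>L 'a" assume a: "a \<in> effects" and b: "b \<in> effects"
  have "\<exists>s. \<forall>n. s n \<in> effects \<and> norm (a - s n) \<le> (1/2) ^ n \<and>
      span {x. \<exists>l. s n x = l *\<^sub>R x} = UNIV"
    by (intro choice allI) (use dyadic_approximation[OF a] in blast)
  then obtain s where s: "\<And>n. s n \<in> effects" "\<And>n. norm (a - s n) \<le> (1/2) ^ n"
    "\<And>n. span {x. \<exists>l. s n x = l *\<^sub>R x} = UNIV"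
    by blast
  have "(\<lambda>n. a - s n) \<longlonglongrightarrow> 0"
    by (rule Lim_null_comparison[where g = "\<lambda>n. (1/2) ^ n"])
      (use s(2) in \<open>auto intro: always_eventually LIMSEQ_realpow_zero\<close>)
  then have lim: "s \<longlonglongrightarrow> a"
    using tendsto_diff[OF tendsto_const[of a]] by fastforce
  have ev: "\<forall>\<^sub>F n in sequentially. s n \<in> effects"
    by (intro always_eventually allI s(1))
  \<comment> \<open>The assumed norm continuity in the first coordinate enters here; the right-hand
    side converges by continuity of \<open>op_sqrt\<close>.\<close>
  have "(\<lambda>n. sp (s n) b) \<longlonglongrightarrow> sp a b"
  proof (rule continuous_on_tendsto_compose[OF _ lim a ev])
    show "continuous_on effects (\<lambda>a. sp a b)"
      using assms(3) b unfolding norm_continuous_fst_def by blast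
  qed
  moreover have "(\<lambda>n. op_sqrt (s n)) \<longlonglongrightarrow> op_sqrt a"
    by (rule continuous_on_tendsto_compose[OF continuous_on_op_sqrt lim a ev])
  then have "(\<lambda>n. op_sqrt (s n) o\<^sub>L b o\<^sub>L op_sqrt (s n)) \<longlonglongrightarrow> (op_sqrt a o\<^sub>L b o\<^sub>L op_sqrt a)"
    by (intro bounded_bilinear.tendsto[OF bounded_bilinear_blinfun_compose] tendsto_intros)
  moreover have "sp (s n) b = op_sqrt (s n) o\<^sub>L b o\<^sub>L op_sqrt (s n)" for n
    by (rule sp_spanning_eigenvectors[OF s(1) b s(3)])
  ultimately show "sp a b = op_sqrt a o\<^sub>L b o\<^sub>L op_sqrt a"
    using LIMSEQ_unique by simp
qed

end
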